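(* Let $\Gamma$ be a finitely generated group of fixed price $c$. Then for any Farber sequence $(\Gamma_n)$ in $\Gamma$, the rank gradient exists and $$\mathrm{RG}(\Gamma,(\Gamma_n))=c-1.$$
   Context: **Rank gradient.** For a finitely generated group $H$ let $d(H)$ be its minimal number of generators. For a sequence $(\Gamma_n)$ of finite index subgroups of $\Gamma$ (not necessarily a chain), $\mathrm{RG}(\Gamma,(\Gamma_n))=\lim_{n\to\infty}\frac{d(\Gamma_n)-1}{|\Gamma:\Gamma_n|}$ when this limit exists. **Cost and fixed price.** Let $\Gamma$ act by probability measure preserving (p.m.p.) transformations on a standard Borel probability space $(X,\mu)$, and let $\mathcal{R}$ be the orbit equivalence relation. The cost of the action is $\frac12\inf\int_X\deg_{\mathcal{H}}(x)\,d\mu(x)$, where the infimum is over symmetric Borel graphs $\mathcal{H}\subseteq\mathcal{R}$ on $X$ whose connected components coincide with the $\mathcal{R}$-classes for $\mu$-almost every point. An action is essentially free if $\mu$-almost every point has trivial stabilizer. The group $\Gamma$ has fixed price $c$ if every essentially free p.m.p. action of $\Gamma$ has cost $c$. **Farber sequence.** Let $S$ be a finite symmetric generating set of $\Gamma$. For a finite index subgroup $H\le\Gamma$ the Schreier graph $\mathrm{Sch}(\Gamma,H,S)$ has the cosets of $H$ as vertices, with an edge labeled $s$ from each coset to its image under $s$, for each $s\in S$. A sequence $(\Gamma_n)$ of finite index subgroups of $\Gamma$ is Farber if the Schreier graphs form a sofic approximation of $\Gamma$, i.e. for every $r$ the proportion of vertices $v$ of $\mathrm{Sch}(\Gamma,\Gamma_n,S)$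 whose $r$-ball is isomorphic, as a rooted $S$-edge-labeled graph, to the $r$-ball around the identity in the Cayley graph $\mathrm{Cay}(\Gamma,S)$ tends to $1$ as $n\to\infty$. (This does not depend on $S$.) *)

theory Defs
  imports "HOL-Probability.Probability" "HOL-Algebra.Generated_Groups" "HOL-Algebra.Group_Action"
begin

section \<open>Generators and rank gradient\<close>

definition finitely_generated :: "('a, 'b) monoid_scheme \<Rightarrow> bool" where
  "finitely_generated G \<longleftrightarrow>
     (\<exists>A. finite A \<and> A \<subseteq> carrier G \<and> generate G A = carrier G)"

text \<open>The minimal number of generators; only meaningful for finitely generated groups.
  The trivial group has rank 0, generated by the empty set.\<close>

definition group_rank :: "('a, 'b) monoid_scheme \<Rightarrow> nat" where
  "group_rank G =
     (LEAST n. \<exists>A. finite A \<and> card A = n \<and> A \<subseteq> carrier G \<and> generate G A = carrier G)"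

definition subgroup_index :: "('a, 'b) monoid_scheme \<Rightarrow> 'a set \<Rightarrow> nat" where
  "subgroup_index G H = card (rcosets\<^bsub>G\<^esub> H)"

definition rank_ratio :: "('a, 'b) monoid_scheme \<Rightarrow> 'a set \<Rightarrow> real" where
  "rank_ratio G H = (real (group_rank (G\<lparr>carrier := H\<rparr>)) - 1) / real (subgroup_index G H)"

definition rank_gradient_exists :: "('a, 'b) monoid_scheme \<Rightarrow> (nat \<Rightarrow> 'a set) \<Rightarrow> bool" where
  "rank_gradient_exists G H \<longleftrightarrow> convergent (\<lambda>n. rank_ratio G (H n))"

definition rank_gradient :: "('a, 'b) monoid_scheme \<Rightarrow> (nat \<Rightarrow> 'a set) \<Rightarrow> real" where
  "rank_gradient G H = lim (\<lambda>n. rank_ratio G (H n))"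


section \<open>Measure preserving actions, cost and fixed price\<close>

text \<open>A standard Borel space: its \<open>\<sigma>\<close>-algebra is the Borel \<open>\<sigma>\<close>-algebra of some Polish
  topology on the underlying set.\<close>

definition standard_borel :: "'x measure \<Rightarrow> bool" where
  "standard_borel M \<longleftrightarrow>
     (\<exists>T. topspace T = space M \<and> separable_space T \<and> completely_metrizable_space T \<and>
          sets M = sigma_sets (space M) {U. openin T U})"

definition pmp_action ::
    "('a, 'b) monoid_scheme \<Rightarrow> 'x measure \<Rightarrow> ('a \<Rightarrow> 'x \<Rightarrow> 'x) \<Rightarrow> bool" where
  "pmp_action G M \<phi> \<longleftrightarrow>
     standard_borel M \<and> prob_space M \<and> group_action G (space M) \<phi> \<and>
     (\<forall>g\<in>carrier G. \<phi> g \<in> measurable M M \<and> distr M M (\<phi> g) = M)"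

definition essentially_free ::
    "('a, 'b) monoid_scheme \<Rightarrow> 'x measure \<Rightarrow> ('a \<Rightarrow> 'x \<Rightarrow> 'x) \<Rightarrow> bool" where
  "essentially_free G M \<phi> \<longleftrightarrow> (AE x in M. stabilizer G \<phi> x = {\<one>\<^bsub>G\<^esub>})"

definition orbit_relation ::
    "('a, 'b) monoid_scheme \<Rightarrow> 'x measure \<Rightarrow> ('a \<Rightarrow> 'x \<Rightarrow> 'x) \<Rightarrow> ('x \<times> 'x) set" where
  "orbit_relation G M \<phi> = {(x, y). x \<in> space M \<and> y \<in> orbit G \<phi> x}"

text \<open>Graphs are loopless; admitting loops would only increase degrees, so the infimum below
  would be the same. As \<open>H\<close> is symmetric, \<open>H\<^sup>* `` {x}\<close> is the connected component of \<open>x\<close>.\<close>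

definition graphings :: "'x measure \<Rightarrow> ('x \<times> 'x) set \<Rightarrow> ('x \<times> 'x) set set" where
  "graphings M R =
     {H \<in> sets (M \<Otimes>\<^sub>M M). H \<subseteq> R \<and> sym H \<and> irrefl H \<and> (AE x in M. H\<^sup>* `` {x} = R `` {x})}"

definition graph_degree :: "('x \<times> 'x) set \<Rightarrow> 'x \<Rightarrow> ennreal" where
  "graph_degree H x = emeasure (count_space UNIV) (H `` {x})"

definition cost ::
    "('a, 'b) monoid_scheme \<Rightarrow> 'x measure \<Rightarrow> ('a \<Rightarrow> 'x \<Rightarrow> 'x) \<Rightarrow> ereal" where
  "cost G M \<phi> =
     enn2ereal ((INF H\<in>graphings M (orbit_relation G M \<phi>). \<integral>\<^sup>+x. graph_degree H x \<partial>M) / 2)"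

text \<open>HOL cannot quantify over all types inside a formula. Every standard Borel space has at most
  the cardinality of the continuum, so any action on one can be transported along an injection to
  a standard Borel space whose points are real numbers. Letting \<open>M\<close> range over all measures
  on subsets of \<^typ>\<open>real\<close>, with an arbitrary standard Borel \<open>\<sigma>\<close>-algebra, therefore covers all
  standard Borel probability spaces up to isomorphism.\<close>

definition fixed_price :: "('a, 'b) monoid_scheme \<Rightarrow> real \<Rightarrow> bool" where
  "fixed_price G c \<longleftrightarrow>
     (\<forall>(M :: real measure) \<phi>.
        pmp_action G M \<phi> \<and> essentially_free G M \<phi> \<longrightarrow> cost G M \<phi> = ereal c)"


section \<open>Farber sequences\<close>

text \<open>An edge \<open>(x, s, y)\<close> goes from \<open>x\<close> to \<open>y\<close> and is labeled \<open>s\<close>.\<close>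

record ('v, 'l) labeled_graph =
  vertices :: "'v set"
  edges :: "('v \<times> 'l \<times> 'v) set"

definition adjacency :: "('v, 'l) labeled_graph \<Rightarrow> ('v \<times> 'v) set" where
  "adjacency A = {(x, y). \<exists>s. (x, s, y) \<in> edges A \<or> (y, s, x) \<in> edges A}"

text \<open>The subgraph induced on the vertices at graph distance at most \<open>r\<close> from \<open>v\<close>.\<close>

definition graph_ball :: "('v, 'l) labeled_graph \<Rightarrow> 'v \<Rightarrow> nat \<Rightarrow> ('v, 'l) labeled_graph" where
  "graph_ball A v r =
     (let W = {w \<in> vertices A. \<exists>k\<le>r. (v, w) \<in> adjacency A ^^ k}
      in \<lparr>vertices = W, edges = {(x, s, y) \<in> edges A. x \<in> W \<and> y \<in> W}\<rparr>)"

definition rooted_isomorphic ::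
    "('v, 'l) labeled_graph \<Rightarrow> 'v \<Rightarrow> ('w, 'l) labeled_graph \<Rightarrow> 'w \<Rightarrow> bool" where
  "rooted_isomorphic A v B w \<longleftrightarrow>
     (\<exists>f. bij_betw f (vertices A) (vertices B) \<and> f v = w \<and>
          (\<forall>x\<in>vertices A. \<forall>y\<in>vertices A. \<forall>s. (x, s, y) \<in> edges A \<longleftrightarrow> (f x, s, f y) \<in> edges B))"

text \<open>Right cosets, on which the group acts by right multiplication.\<close>

definition schreier_graph ::
    "('a, 'b) monoid_scheme \<Rightarrow> 'a set \<Rightarrow> 'a set \<Rightarrow> ('a set, 'a) labeled_graph" where
  "schreier_graph G H S =
     \<lparr>vertices = rcosets\<^bsub>G\<^esub> H, edges = {(C, s, C #>\<^bsub>G\<^esub> s) | C s. C \<in> rcosets\<^bsub>G\<^esub> H \<and> s \<in> S}\<rparr>"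

definition cayley_graph :: "('a, 'b) monoid_scheme \<Rightarrow> 'a set \<Rightarrow> ('a, 'a) labeled_graph" where
  "cayley_graph G S =
     \<lparr>vertices = carrier G, edges = {(g, s, g \<otimes>\<^bsub>G\<^esub> s) | g s. g \<in> carrier G \<and> s \<in> S}\<rparr>"

definition finite_symmetric_generating_set :: "('a, 'b) monoid_scheme \<Rightarrow> 'a set \<Rightarrow> bool" where
  "finite_symmetric_generating_set G S \<longleftrightarrow>
     finite S \<and> S \<subseteq> carrier G \<and> (\<forall>s\<in>S. inv\<^bsub>G\<^esub> s \<in> S) \<and> generate G S = carrier G"

definition good_vertices ::
    "('a, 'b) monoid_scheme \<Rightarrow> 'a set \<Rightarrow> 'a set \<Rightarrow> nat \<Rightarrow> 'a set set" where
  "good_vertices G H S r =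
     {v \<in> vertices (schreier_graph G H S).
        rooted_isomorphic (graph_ball (schreier_graph G H S) v r) v
                          (graph_ball (cayley_graph G S) \<one>\<^bsub>G\<^esub> r) \<one>\<^bsub>G\<^esub>}"

definition farber_wrt ::
    "('a, 'b) monoid_scheme \<Rightarrow> 'a set \<Rightarrow> (nat \<Rightarrow> 'a set) \<Rightarrow> bool" where
  "farber_wrt G S H \<longleftrightarrow>
     (\<forall>r. (\<lambda>n. real (card (good_vertices G (H n) S r)) /
               real (card (vertices (schreier_graph G (H n) S)))) \<longlonglongrightarrow> 1)"

text \<open>The property \<^const>\<open>farber_wrt\<close> does not depend on the finite symmetric generating set, so
  asking for it for some such set is the same as asking for it for all of them.\<close>

definition farber_sequence :: "('a, 'b) monoid_scheme \<Rightarrow> (nat \<Rightarrow> 'a set) \<Rightarrow> bool" where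
  "farber_sequence G H \<longleftrightarrow>
     (\<forall>n. subgroup (H n) G \<and> finite (rcosets\<^bsub>G\<^esub> (H n))) \<and>
     (\<exists>S. finite_symmetric_generating_set G S \<and> farber_wrt G S H)"

end

theory Submission
  imports Defs
begin

text \<open>Both bounds come from Bernoulli shifts. Lower bound: for a subgroup \<open>H\<close> of index \<open>N\<close> the
  product of the shift with the action on the cosets of \<open>H\<close> is free, and it is generated by a graph of
  cost \<open>(d(H) + N - 1) / N\<close>, so \<open>c - 1 \<le> (d(H) - 1) / N\<close> for every \<open>H\<close>. Upper bound: a graphing of
  the shift of cost close to \<open>c\<close> can be replaced, at small expense, by finitely many labelled
  cylinder sets in which \<^emph>\<open>every\<close> point is joined to its translate by each generator along a path with
  the right label. Evaluating these local rules at independent random labels on the cosets of \<open>\<Gamma>\<^sub>n\<close>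
  gives a graph whose expected number of edges is at most about \<open>c |\<Gamma> : \<Gamma>\<^sub>n|\<close>, as most cosets look
  like the identity of the group. The label condition makes the closed paths of this graph at the
  root generate \<open>\<Gamma>\<^sub>n\<close>, and a connected graph with \<open>e\<close> edges and \<open>N\<close> vertices has a fundamental
  group of rank \<open>e - N + 1\<close>.\<close>

section \<open>Generators from connected graphs of cosets\<close>

text \<open>The local rule has to connect every point, not almost every one. When the group is
  infinite, a labelling read off from finitely many cosets repeats values, so all sampled points lie
  in a null set of the shift space, where a graphing promises nothing. A cylinder sees only a finite
  window, and on a window that the cosets do not fold the sampled labels have the right law. Cosets
  with a folded window are few by the Farber condition, and their edges are bounded crudely by the
  number of labels in the rule. Labels are tracked because endpoints are not enough: a path of
  cosets from \<open>v\<close> to \<open>v #> s\<close> may have a label product other than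
  \<open>s\<close>, and connectedness alone would not produce generators of the subgroup. In the
  shift, freeness turns equality of endpoints into equality of products, and this stronger statement
  survives on cosets. Atomless labels serve twice: they make the shift free, even for a finite
  group, and comparing two of them orients the edges.\<close>

fun word_val :: "('a, 'b) monoid_scheme \<Rightarrow> 'a list \<Rightarrow> 'a" where
  "word_val G [] = \<one>\<^bsub>G\<^esub>"
| "word_val G (g # w) = g \<otimes>\<^bsub>G\<^esub> word_val G w"

text \<open>The action \<open>m\<close> is a parameter so that one notion serves both cosets and
  points of the shift. An edge may be crossed backwards, which is the second disjunct.\<close>

fun walk :: "('a, 'b) monoid_scheme \<Rightarrow> ('x \<Rightarrow> 'a \<Rightarrow> 'x) \<Rightarrow> ('x \<times> 'a) set \<Rightarrow> 'a list \<Rightarrow> 'x \<Rightarrow> bool" where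
  "walk G m E [] x \<longleftrightarrow> True"
| "walk G m E (g # w) x \<longleftrightarrow>
     ((x, g) \<in> E \<or> (m x g, inv\<^bsub>G\<^esub> g) \<in> E) \<and> walk G m E w (m x g)"

text \<open>The product of the labels has to be \<open>s\<close> itself; a walk that merely ends at
  \<open>m x s\<close> would not control the loops at a coset.\<close>

definition walk_connected ::
  "('a, 'b) monoid_scheme \<Rightarrow> ('x \<Rightarrow> 'a \<Rightarrow> 'x) \<Rightarrow> ('x \<times> 'a) set \<Rightarrow> 'a set \<Rightarrow> 'x \<Rightarrow> bool" where
  "walk_connected G m E S x \<longleftrightarrow>
     (\<forall>s\<in>S. \<exists>w\<in>lists (carrier G). word_val G w = s \<and> walk G m E w x)"

lemma (in group) word_val_closed [simp]:
  "w \<in> lists (carrier G) \<Longrightarrow> word_val G w \<in> carrier G"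
  by (induction w) auto

lemma (in group) rcosets_closed:
  assumes "subgroup H G" "v \<in> rcosets H" "g \<in> carrier G"
  shows "v #> g \<in> rcosets H"
proof -
  interpret subgroup H G by fact
  show ?thesis
    using assms by (auto simp: RCOSETS_def coset_mult_assoc subset)
qed

lemma (in group) rcoset_mult:
  assumes "subgroup H G" "v \<in> rcosets H" "g \<in> carrier G" "h \<in> carrier G"
  shows "v #> g #> h = v #> (g \<otimes> h)"
  using assms subgroup.rcosets_carrier[OF assms(1) is_group assms(2)] by (intro coset_mult_assoc) auto

lemma (in group) rcoset_one:
  assumes "subgroup H G" "v \<in> rcosets H"
  shows "v #> \<one> = v"
  using subgroup.rcosets_carrier[OF assms(1) is_group assms(2)] by simp

lemma (in group) rcoset_mult_inv:
  assumes "subgroup H G" "v \<in> rcosets H" "g \<in> carrier G"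
  shows "v #> g #> inv g = v" "v #> inv g #> g = v"
  using assms by (simp_all add: rcoset_mult rcoset_one)

lemma (in group) subgroup_in_own_rcosets:
  assumes "subgroup H G" shows "H \<in> rcosets H"
  using subgroup.subgroup_in_rcosets[OF assms is_group] .

text \<open>Pairs of a coset and a group element form the action groupoid, and \<open>Q\<close> is a
  subgroupoid containing the edges. Every generator is the product of a walk from every coset, so
  \<open>Q\<close> contains all generators and hence everything. It is applied to cuts when a tree
  is grown, and to Schreier generators.\<close>

lemma (in group) walk_connected_induct:
  assumes H: "subgroup H G" and S: "S \<subseteq> carrier G" "generate G S = carrier G"
    and conn: "\<And>v. v \<in> rcosets H \<Longrightarrow> walk_connected G (#>) E S v"
    and one: "\<And>v. v \<in> rcosets H \<Longrightarrow> Q v \<one>"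
    and edge: "\<And>v g. v \<in> rcosets H \<Longrightarrow> g \<in> carrier G \<Longrightarrow> (v, g) \<in> E \<Longrightarrow> Q v g"
    and mult: "\<And>v g h. v \<in> rcosets H \<Longrightarrow> g \<in> carrier G \<Longrightarrow> h \<in> carrier G \<Longrightarrow>
       Q v g \<Longrightarrow> Q (v #> g) h \<Longrightarrow> Q v (g \<otimes> h)"
    and flip: "\<And>v g. v \<in> rcosets H \<Longrightarrow> g \<in> carrier G \<Longrightarrow> Q v g \<Longrightarrow> Q (v #> g) (inv g)"
    and v: "v \<in> rcosets H" and g: "g \<in> carrier G"
  shows "Q v g"
proof -
  have word: "Q u (word_val G w)"
    if "w \<in> lists (carrier G)" "walk G (#>) E w u" "u \<in> rcosets H" for w u
    using that
  proof (induction w arbitrary: u)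
    case (Cons a w)
    have a: "a \<in> carrier G" "u #> a \<in> rcosets H"
      using Cons.hyps Cons.prems rcosets_closed[OF H, of u a] by (auto simp del: walk.simps)
    have "Q u a"
    proof (cases "(u, a) \<in> E")
      case False
      then have "Q (u #> a) (inv a)"
        using Cons.prems a by (intro edge) auto
      from flip[OF a(2) _ this] show ?thesis
        using a Cons.prems by (simp add: rcoset_mult_inv[OF H])
    qed (use Cons.prems a edge in auto)
    moreover have "Q (u #> a) (word_val G w)" using Cons.IH[of "u #> a"] Cons.prems a by simp
    ultimately show ?case
      using mult[of u a "word_val G w"] Cons.prems a word_val_closed[OF Cons.hyps(2)] by simp
  qed (use one in auto)
  have gen: "Q u s" if s: "s \<in> S" and u: "u \<in> rcosets H" for u s
  proof -
    obtain w where "w \<in> lists (carrier G)" "word_val G w = s" "walk G (#>) E w u"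
      using conn[OF u] s by (auto simp: walk_connected_def)
    then show ?thesis using word[of w u] u by simp
  qed
  have "\<forall>u\<in>rcosets H. Q u a" if "a \<in> generate G S" for a
    using that
  proof induction
    case (incl h)
    then show ?case using gen by simp
  next
    case (inv h)
    then have h: "h \<in> carrier G" using S by auto
    show ?case
    proof
      fix u assume u: "u \<in> rcosets H"
      then have "u #> inv h \<in> rcosets H" using h rcosets_closed[OF H] by auto
      moreover from this have "Q (u #> inv h) h"
        using inv gen by simp
      ultimately show "Q u (inv h)"
        using flip[of "u #> inv h" h] h u by (simp add: rcoset_mult_inv[OF H])
    qed
  next
    case (eng h1 h2)
    then have h: "h1 \<in> carrier G" "h2 \<in> carrier G" using S by auto
    show ?case
    proof
      fix u assume u: "u \<in> rcosets H"
      show "Q u (h1 \<otimes> h2)"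
        using mult[OF u h] eng u rcosets_closed[OF H u h(1)] by simp
    qed
  qed (use one in simp)
  then show ?thesis using v g S by simp
qed

section \<open>Spanning trees and Schreier generators\<close>

lemma (in group) rcosets_transitive:
  assumes "subgroup H G" "v \<in> rcosets H"
  obtains a where "a \<in> carrier G" "v = H #> a"
  using assms by (auto simp: RCOSETS_def)

text \<open>A spanning tree with \<open>k\<close> vertices grown inside the edge set \<open>E\<close>; the element \<open>t v\<close> is
  the label of the path in the tree from the root \<open>H\<close> to \<open>v\<close>.\<close>

definition coset_tree ::
  "('a, 'b) monoid_scheme \<Rightarrow> 'a set \<Rightarrow> ('a set \<times> 'a) set \<Rightarrow> nat \<Rightarrow>
     'a set set \<Rightarrow> ('a set \<times> 'a) set \<Rightarrow> ('a set \<Rightarrow> 'a) \<Rightarrow> bool" where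
  "coset_tree G H E k W F t \<longleftrightarrow>
     W \<subseteq> rcosets\<^bsub>G\<^esub> H \<and> H \<in> W \<and> finite W \<and> card W = k \<and> F \<subseteq> E \<and> card F + 1 = k \<and>
     t H = \<one>\<^bsub>G\<^esub> \<and> (\<forall>v\<in>W. t v \<in> carrier G \<and> v = H #>\<^bsub>G\<^esub> t v) \<and>
     (\<forall>(v, g)\<in>F. v \<in> W \<and> v #>\<^bsub>G\<^esub> g \<in> W \<and> t (v #>\<^bsub>G\<^esub> g) = t v \<otimes>\<^bsub>G\<^esub> g)"

text \<open>A tree that misses a coset can be extended by an edge across its boundary. Without such
  an edge, membership in \<open>W\<close> would be invariant along \<open>E\<close>, hence under the
  whole group, which acts transitively on the cosets.\<close>

lemma (in group) coset_tree_exists: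
  assumes H: "subgroup H G" and fin: "finite (rcosets H)"
    and S: "S \<subseteq> carrier G" "generate G S = carrier G"
    and E: "finite E" "E \<subseteq> (rcosets H) \<times> carrier G"
    and conn: "\<And>v. v \<in> rcosets H \<Longrightarrow> walk_connected G (#>) E S v"
    and k: "1 \<le> k" "k \<le> card (rcosets H)"
  shows "\<exists>W F t. coset_tree G H E k W F t"
  using k
proof (induction k rule: dec_induct)
  case base
  have "coset_tree G H E 1 {H} {} (\<lambda>_. \<one>)"
    using subgroup_in_own_rcosets[OF H] subgroup.subset[OF H]
    by (auto simp: coset_tree_def)
  then show ?case by auto
next
  case (step k)
  then obtain W F t where T: "coset_tree G H E k W F t" by auto
  have "finite F" using T E(1) finite_subset by (auto simp: coset_tree_def)
  have "W \<noteq> rcosets H" using T step by (auto simp: coset_tree_def)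
  then obtain u where u: "u \<in> rcosets H" "u \<notin> W" using T by (auto simp: coset_tree_def)
  have "\<exists>v g. (v, g) \<in> E \<and> (v \<in> W \<longleftrightarrow> v #> g \<notin> W)"
  proof (rule ccontr)
    assume neg: "\<not> ?thesis"
    have Q: "v \<in> W \<longleftrightarrow> v #> g \<in> W" if "v \<in> rcosets H" "g \<in> carrier G" for v g
    proof (rule walk_connected_induct[where Q = "\<lambda>v g. v \<in> W \<longleftrightarrow> v #> g \<in> W" and E = E and S = S and H = H])
    qed (use neg H S conn that in \<open>auto simp: rcoset_mult rcoset_one rcoset_mult_inv\<close>)
    obtain a where "a \<in> carrier G" "u = H #> a"
      using rcosets_transitive[OF H u(1)] by auto
    then show False
      using Q[of H a] subgroup_in_own_rcosets[OF H] T u by (auto simp: coset_tree_def)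
  qed
  then obtain v g where vg: "(v, g) \<in> E" "v \<in> W \<longleftrightarrow> v #> g \<notin> W" by auto
  have vg': "v \<in> rcosets H" "g \<in> carrier G" using vg E by auto
  have nF: "(v, g) \<notin> F" using vg T by (auto simp: coset_tree_def)
  have car: "H \<subseteq> carrier G" using H by (rule subgroup.subset)
  show ?case
  proof (cases "v \<in> W")
    case True
    let ?t = "t(v #> g := t v \<otimes> g)"
    have "v #> g = H #> (t v \<otimes> g)"
      using T True vg' car by (auto simp: coset_tree_def coset_mult_assoc[symmetric])
    then have "coset_tree G H E (Suc k) (insert (v #> g) W) (insert (v, g) F) ?t"
      using T vg vg' nF True \<open>finite F\<close> rcosets_closed[OF H]
      unfolding coset_tree_def by auto
    then show ?thesis by blast
  next
    case False
    \<comment> \<open>Here the crossing edge points into the tree, so the new vertex is its source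
      and the label is undone.\<close>
    let ?t = "t(v := t (v #> g) \<otimes> inv g)"
    have W: "v #> g \<in> W" using False vg by auto
    then have tg: "t (v #> g) \<in> carrier G" "v #> g = H #> t (v #> g)"
      using T by (auto simp: coset_tree_def)
    have "v = v #> g #> inv g" using vg' by (simp add: rcoset_mult_inv[OF H])
    also have "\<dots> = H #> t (v #> g) #> inv g" using tg(2) by simp
    also have "\<dots> = H #> (t (v #> g) \<otimes> inv g)"
      using tg(1) vg' car by (simp add: coset_mult_assoc)
    finally have "v = H #> (t (v #> g) \<otimes> inv g)" .
    moreover have "t (v #> g) = t (v #> g) \<otimes> inv g \<otimes> g"
      using tg(1) vg' by (simp add: m_assoc)
    ultimately have "coset_tree G H E (Suc k) (insert v W) (insert (v, g) F) ?t"
      using T vg vg' nF False W tg(1) \<open>finite F\<close>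
      unfolding coset_tree_def by auto
    then show ?thesis by blast
  qed
qed

text \<open>Schreier's generators, of which those belonging to tree edges are trivial.\<close>

lemma (in group) subgroup_generators_from_edges:
  assumes H: "subgroup H G" and fin: "finite (rcosets H)"
    and S: "S \<subseteq> carrier G" "generate G S = carrier G"
    and E: "finite E" "E \<subseteq> (rcosets H) \<times> carrier G"
    and conn: "\<And>v. v \<in> rcosets H \<Longrightarrow> walk_connected G (#>) E S v"
  shows "\<exists>A. finite A \<and> A \<subseteq> H \<and> generate G A = H \<and> card A + card (rcosets H) \<le> card E + 1"
proof -
  have "card (rcosets H) \<ge> 1"
    using fin subgroup_in_own_rcosets[OF H] by (metis One_nat_def Suc_leI card_gt_0_iff empty_iff)
  from coset_tree_exists[OF H fin S E conn this] obtain W F t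
    where T: "coset_tree G H E (card (rcosets H)) W F t" by auto
  then have W: "W = rcosets H" using card_subset_eq[OF fin, of W] by (simp add: coset_tree_def)
  have t: "t v \<in> carrier G" "H #> t v = v" if "v \<in> rcosets H" for v
    using T that W by (auto simp: coset_tree_def)
  define q where "q = (\<lambda>(v, g). t v \<otimes> g \<otimes> inv (t (v #> g)))"
  define A where "A = q ` (E - F)"
  have car: "H \<subseteq> carrier G" using H by (rule subgroup.subset)
  have "q (v, g) \<in> H" if "v \<in> rcosets H" "g \<in> carrier G" for v g
  proof -
    have vg: "v #> g \<in> rcosets H" using rcosets_closed[OF H that] .
    have "H #> (t v \<otimes> g) = H #> t (v #> g)"
      using t that vg car by (simp add: coset_mult_assoc[symmetric])
    then have "t v \<otimes> g \<in> H #> t (v #> g)"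
      using rcos_self[OF _ H] t that by (metis m_closed)
    then show ?thesis
      unfolding q_def using t that vg H by (auto simp: subgroup.rcos_module_imp)
  qed
  then have AH: "A \<subseteq> H" using E by (auto simp: A_def)
  have "card A \<le> card (E - F)" unfolding A_def using E by (auto intro: card_image_le)
  moreover have FE: "F \<subseteq> E" "card F + 1 = card (rcosets H)" using T by (auto simp: coset_tree_def)
  moreover have "card (E - F) = card E - card F"
    using FE(1) finite_subset[OF FE(1) E(1)] by (rule card_Diff_subset[rotated])
  moreover have "card F \<le> card E" using FE E by (auto intro: card_mono)
  ultimately have card: "card A + card (rcosets H) \<le> card E + 1" by auto
  have Acar: "A \<subseteq> carrier G" using AH car by auto
  \<comment> \<open>\<open>q\<close> is multiplicative on the action groupoid because the inner
    factors \<open>t (v #> g)\<close> cancel. Its values on \<open>E\<close> therefore determine the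
    subgroup that contains all its values.\<close>
  have K: "q (v, g) \<in> generate G A" if "v \<in> rcosets H" "g \<in> carrier G" for v g
  proof (rule walk_connected_induct[where Q = "\<lambda>v g. q (v, g) \<in> generate G A"
        and E = E and S = S and H = H])
    fix v assume "v \<in> rcosets H"
    then show "q (v, \<one>) \<in> generate G A"
      using t by (simp add: q_def rcoset_one[OF H] generate.one)
  next
    fix v g assume a: "v \<in> rcosets H" "g \<in> carrier G" "(v, g) \<in> E"
    show "q (v, g) \<in> generate G A"
    proof (cases "(v, g) \<in> F")
      case True
      then have "t (v #> g) = t v \<otimes> g" using T by (auto simp: coset_tree_def)
      then have "q (v, g) = \<one>" using t a by (simp add: q_def)
      then show ?thesis by (simp add: generate.one)
    next
      case False
      then show ?thesis using a by (auto simp: A_def intro: generate.incl)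
    qed
  next
    fix v g h assume a: "v \<in> rcosets H" "g \<in> carrier G" "h \<in> carrier G"
      "q (v, g) \<in> generate G A" "q (v #> g, h) \<in> generate G A"
    have c: "v #> g \<in> rcosets H" "v #> (g \<otimes> h) \<in> rcosets H" using a rcosets_closed[OF H] by auto
    have "inv (t (v #> g)) \<otimes> (t (v #> g) \<otimes> h \<otimes> inv (t (v #> (g \<otimes> h)))) =
      h \<otimes> inv (t (v #> (g \<otimes> h)))"
      using a c t by (simp add: m_assoc[symmetric])
    then have "q (v, g \<otimes> h) = q (v, g) \<otimes> q (v #> g, h)"
      using a c t by (simp add: q_def rcoset_mult[OF H] m_assoc)
    then show "q (v, g \<otimes> h) \<in> generate G A" using a by (auto intro: generate.eng)
  next
    fix v g assume a: "v \<in> rcosets H" "g \<in> carrier G" "q (v, g) \<in> generate G A"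
    have c: "v #> g \<in> rcosets H" using a rcosets_closed[OF H] by auto
    have "q (v #> g, inv g) = inv (q (v, g))"
      using a c t by (simp add: q_def rcoset_mult_inv[OF H] inv_mult_group m_assoc)
    then show "q (v #> g, inv g) \<in> generate G A"
      using a generate_m_inv_closed[OF Acar] by auto
  qed (use H S conn that in auto)
  have "generate G A = H"
  proof
    show "generate G A \<subseteq> H" using generate_subgroup_incl[OF AH H] .
    show "H \<subseteq> generate G A"
    proof
      fix h assume h: "h \<in> H"
      \<comment> \<open>At the root the tree label is trivial, so \<open>q\<close> returns each
        \<open>h \<in> H\<close> unchanged and all of \<open>H\<close> is reached.\<close>
      have "H #> h = H" using h H car coset_join2 by blast
      moreover have "t H = \<one>" using T by (auto simp: coset_tree_def)
      ultimately have "q (H, h) = h" using h car by (auto simp: q_def)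
      then show "h \<in> generate G A" using K[of H h] subgroup_in_own_rcosets[OF H] h car by auto
    qed
  qed
  then show ?thesis using card AH E by (auto simp: A_def intro!: exI[of _ A])
qed

section \<open>Rank of finite index subgroups\<close>

lemma (in group) group_rank_le:
  assumes "subgroup H G" "finite A" "A \<subseteq> H" "generate G A = H"
  shows "group_rank (G\<lparr>carrier := H\<rparr>) \<le> card A"
  unfolding group_rank_def
  by (rule Least_le) (use assms generate_consistent in auto)

lemma (in group) group_rank_attained:
  assumes "subgroup H G" "finite A" "A \<subseteq> H" "generate G A = H"
  obtains B where "finite B" "B \<subseteq> H" "generate G B = H" "card B = group_rank (G\<lparr>carrier := H\<rparr>)"
proof -
  have "\<exists>B. finite B \<and> card B = group_rank (G\<lparr>carrier := H\<rparr>) \<and> B \<subseteq> carrier (G\<lparr>carrier := H\<rparr>) \<and>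
      generate (G\<lparr>carrier := H\<rparr>) B = carrier (G\<lparr>carrier := H\<rparr>)"
    unfolding group_rank_def
    by (rule LeastI_ex) (use assms generate_consistent in auto)
  then show ?thesis using that assms generate_consistent by auto
qed

lemma (in group) rank_bound_edges:
  assumes "subgroup H G" "finite (rcosets H)"
    and "S \<subseteq> carrier G" "generate G S = carrier G"
    and "finite E" "E \<subseteq> (rcosets H) \<times> carrier G"
    and "\<And>v. v \<in> rcosets H \<Longrightarrow> walk_connected G (#>) E S v"
  shows "group_rank (G\<lparr>carrier := H\<rparr>) + card (rcosets H) \<le> card E + 1"
  using subgroup_generators_from_edges[OF assms] group_rank_le[OF assms(1)] by fastforce

text \<open>\<open>group_rank\<close> is a least number and is attained only once some finite
  generating set is known. The full Schreier graph, connected by words of one letter, supplies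
  one.\<close>

lemma (in group) finite_index_generators:
  assumes H: "subgroup H G" "finite (rcosets H)"
    and S: "finite S" "S \<subseteq> carrier G" "generate G S = carrier G"
  obtains B where "finite B" "B \<subseteq> H" "generate G B = H" "card B = group_rank (G\<lparr>carrier := H\<rparr>)"
proof -
  have "walk_connected G (#>) ((rcosets H) \<times> S) S v" if "v \<in> rcosets H" for v
    unfolding walk_connected_def
  proof
    fix s assume "s \<in> S"
    then show "\<exists>w\<in>lists (carrier G). word_val G w = s \<and> walk G (#>) ((rcosets H) \<times> S) w v"
      using S that by (intro bexI[of _ "[s]"]) auto
  qed
  then have "\<exists>A. finite A \<and> A \<subseteq> H \<and> generate G A = H \<and>
      card A + card (rcosets H) \<le> card ((rcosets H) \<times> S) + 1"
    using H S by (intro subgroup_generators_from_edges[where S = S]) auto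
  then show ?thesis using group_rank_attained[OF H(1)] that by metis
qed

section \<open>Farber sequences and injective windows\<close>

text \<open>Preservation of labelled edges forces the isomorphism \<open>f\<close> to send
  \<open>v #> word_val G w\<close> to \<open>word_val G w\<close> for every short word. So
  \<open>f\<close> recovers \<open>h\<close> from \<open>v #> h\<close>.\<close>

lemma (in group) schreier_ball_iso_inj:
  assumes H: "subgroup H G" and S: "S \<subseteq> carrier G"
    and v: "v \<in> good_vertices G H S r"
    and w: "\<And>h. h \<in> F \<Longrightarrow> \<exists>w\<in>lists S. length w \<le> r \<and> word_val G w = h"
  shows "inj_on (\<lambda>h. v #> h) F"
proof -
  let ?A = "schreier_graph G H S" and ?C = "cayley_graph G S"
  have vH: "v \<in> rcosets H" using v by (auto simp: good_vertices_def schreier_graph_def)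
  obtain f where f: "f v = \<one>"
    "\<And>x y s. x \<in> vertices (graph_ball ?A v r) \<Longrightarrow> y \<in> vertices (graph_ball ?A v r) \<Longrightarrow>
      (x, s, y) \<in> edges (graph_ball ?A v r) \<Longrightarrow> (f x, s, f y) \<in> edges (graph_ball ?C \<one> r)"
    using v unfolding good_vertices_def rooted_isomorphic_def by blast
  have ball: "f (v #> word_val G w) = word_val G w \<and>
      (v, v #> word_val G w) \<in> adjacency ?A ^^ length w"
    if "w \<in> lists S" "length w \<le> r" for w
    using that
  \<comment> \<open>Words grow at the right end: the prefix stays in the ball, and the last letter
    is a single edge inside it.\<close>
  proof (induction w rule: rev_induct)
    case Nil
    then show ?case using f vH by (simp add: rcoset_one[OF H])
  next
    case (snoc s w)
    have s: "s \<in> S" "s \<in> carrier G" and wc: "w \<in> lists (carrier G)" using snoc S by auto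
    let ?x = "v #> word_val G w"
    have app: "word_val G (w @ [s]) = word_val G w \<otimes> s"
      using wc s by (induction w) (auto simp: m_assoc)
    have xs: "v #> word_val G (w @ [s]) = ?x #> s"
      using vH wc s by (simp add: app rcoset_mult[OF H])
    have x: "?x \<in> rcosets H" "?x #> s \<in> rcosets H" using rcosets_closed[OF H] vH wc s by auto
    have IH: "f ?x = word_val G w" "(v, ?x) \<in> adjacency ?A ^^ length w"
      using snoc by auto
    have edge: "(?x, s, ?x #> s) \<in> edges ?A" using x s by (auto simp: schreier_graph_def)
    then have "(?x, ?x #> s) \<in> adjacency ?A" by (auto simp: adjacency_def)
    then have adj: "(v, ?x #> s) \<in> adjacency ?A ^^ Suc (length w)"
      using IH(2) by auto
    have inb: "?x \<in> vertices (graph_ball ?A v r)" "?x #> s \<in> vertices (graph_ball ?A v r)"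
      using IH(2) adj x snoc.prems(2) unfolding graph_ball_def schreier_graph_def Let_def
      by (auto simp del: relpow.simps intro: Suc_leD)
    moreover from this edge have "(?x, s, ?x #> s) \<in> edges (graph_ball ?A v r)"
      by (auto simp: graph_ball_def Let_def)
    ultimately have "(f ?x, s, f (?x #> s)) \<in> edges (graph_ball ?C \<one> r)" by (rule f(2))
    then have "f (?x #> s) = f ?x \<otimes> s"
      by (auto simp: graph_ball_def cayley_graph_def Let_def)
    then show ?case using IH(1) xs app adj by simp
  qed
  show ?thesis
  proof (rule inj_onI)
    fix h k assume "h \<in> F" "k \<in> F" "v #> h = v #> k"
    then show "h = k" using w ball by metis
  qed
qed

lemma (in group) words_of_generators:
  assumes S: "finite_symmetric_generating_set G S" and g: "g \<in> carrier G"
  shows "\<exists>w\<in>lists S. word_val G w = g"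
proof -
  have car: "S \<subseteq> carrier G" and sym: "\<forall>s\<in>S. inv s \<in> S" and gen: "generate G S = carrier G"
    using S by (auto simp: finite_symmetric_generating_set_def)
  have app: "word_val G (u @ w) = word_val G u \<otimes> word_val G w"
    if "u \<in> lists S" "w \<in> lists S" for u w
    using that car by (induction u) (auto simp: m_assoc subset_iff in_lists_conv_set)
  have "g \<in> generate G S" using g gen by simp
  then show ?thesis
  proof induction
    case one
    then show ?case by (intro bexI[of _ "[]"]) auto
  next
    case (incl h)
    then show ?case using car by (intro bexI[of _ "[h]"]) auto
  next
    case (inv h)
    then show ?case using car sym by (intro bexI[of _ "[inv h]"]) auto
  next
    case (eng h1 h2)
    then obtain u w where "u \<in> lists S" "word_val G u = h1" "w \<in> lists S" "word_val G w = h2" by auto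
    then show ?case using app by (intro bexI[of _ "u @ w"]) auto
  qed
qed

text \<open>A radius exceeding the lengths of words chosen for \<open>F\<close> makes every good
  vertex an injective window. The upper bound uses the Farber property only in this form.\<close>

lemma (in group) farber_injective_windows:
  assumes S: "finite_symmetric_generating_set G S" and farber: "farber_wrt G S H"
    and H: "\<And>n. subgroup (H n) G" "\<And>n. finite (rcosets (H n))"
    and F: "finite F" "F \<subseteq> carrier G"
  shows "(\<lambda>n. real (card {v \<in> rcosets (H n). \<not> inj_on (\<lambda>h. v #> h) F}) / real (card (rcosets (H n))))
           \<longlonglongrightarrow> 0"
proof -
  have car: "S \<subseteq> carrier G" using S by (auto simp: finite_symmetric_generating_set_def)
  obtain w where w: "\<And>h. h \<in> F \<Longrightarrow> w h \<in> lists S \<and> word_val G (w h) = h"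
    using words_of_generators[OF S] F by (metis subsetD)
  define r where "r = Max (insert 0 ((\<lambda>h. length (w h)) ` F))"
  have r: "length (w h) \<le> r" if "h \<in> F" for h
    unfolding r_def using F that by (intro Max_ge) auto
  have good: "inj_on (\<lambda>h. v #> h) F" if "v \<in> good_vertices G (H n) S r" for v n
    using schreier_ball_iso_inj[OF H(1) car that] w r by blast
  let ?q = "\<lambda>n. real (card (good_vertices G (H n) S r)) / real (card (rcosets (H n)))"
  have "?q \<longlonglongrightarrow> 1"
    using farber by (auto simp: farber_wrt_def schreier_graph_def)
  then have lim: "(\<lambda>n. 1 - ?q n) \<longlonglongrightarrow> 0"
    using tendsto_diff[OF tendsto_const, of ?q 1 sequentially 1] by simp
  show ?thesis
  proof (rule tendsto_sandwich[OF _ _ tendsto_const lim]; intro always_eventually allI)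
    fix n
    let ?N = "rcosets (H n)" and ?B = "{v \<in> rcosets (H n). \<not> inj_on (\<lambda>h. v #> h) F}"
    show "0 \<le> real (card ?B) / real (card ?N)" by simp
    have pos: "card ?N > 0"
      using H(2) subgroup_in_own_rcosets[OF H(1)] by (metis card_gt_0_iff empty_iff)
    have sub: "good_vertices G (H n) S r \<subseteq> ?N"
      by (auto simp: good_vertices_def schreier_graph_def)
    have "card ?B + card (good_vertices G (H n) S r) = card (?B \<union> good_vertices G (H n) S r)"
      using H(2) sub good finite_subset[OF sub] by (intro card_Un_disjoint[symmetric]) auto
    also have "\<dots> \<le> card ?N"
      using H(2) sub by (intro card_mono) auto
    finally have "real (card ?B) \<le> real (card ?N) - real (card (good_vertices G (H n) S r))" by linarith
    then show "real (card ?B) / real (card ?N) \<le> 1 - ?q n"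
      using pos by (simp add: field_simps)
  qed
qed

section \<open>Transporting actions to the reals\<close>

lemma group_actionI:
  assumes "group G"
    and ext: "\<And>g. g \<in> carrier G \<Longrightarrow> \<phi> g \<in> extensional E"
    and into: "\<And>g x. g \<in> carrier G \<Longrightarrow> x \<in> E \<Longrightarrow> \<phi> g x \<in> E"
    and one: "\<And>x. x \<in> E \<Longrightarrow> \<phi> \<one>\<^bsub>G\<^esub> x = x"
    and mult: "\<And>g h x. g \<in> carrier G \<Longrightarrow> h \<in> carrier G \<Longrightarrow> x \<in> E \<Longrightarrow>
       \<phi> (g \<otimes>\<^bsub>G\<^esub> h) x = \<phi> g (\<phi> h x)"
  shows "group_action G E \<phi>"
proof -
  interpret group G by fact
  have inverse: "\<phi> g (\<phi> (inv\<^bsub>G\<^esub> g) x) = x" "\<phi> (inv\<^bsub>G\<^esub> g) (\<phi> g x) = x"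
    if "g \<in> carrier G" "x \<in> E" for g x
    using that one mult[symmetric] by simp_all
  have bij: "\<phi> g \<in> Bij E" if g: "g \<in> carrier G" for g
  proof -
    have "bij_betw (\<phi> g) E E"
      using g into inverse by (intro bij_betw_byWitness[where f' = "\<phi> (inv\<^bsub>G\<^esub> g)"]) auto
    then show ?thesis using ext[OF g] by (simp add: Bij_def)
  qed
  have "\<phi> (g \<otimes>\<^bsub>G\<^esub> h) = compose E (\<phi> g) (\<phi> h)" if "g \<in> carrier G" "h \<in> carrier G" for g h
    using that ext mult by (intro extensionalityI[where A = E]) (auto simp: compose_eq)
  then have "\<phi> \<in> hom G (BijGroup E)"
    using bij by (auto simp: hom_def BijGroup_def)
  then show ?thesis
    by (simp add: group_action_def group_hom_def group_hom_axioms_def group_BijGroup is_group)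
qed

lemma standard_borel_borel:
  fixes M :: "'x::{complete_space, second_countable_topology} measure"
  assumes "sets M = sets borel"
  shows "standard_borel M"
proof -
  have sp: "space M = UNIV" using sets_eq_imp_space_eq[OF assms] by simp
  obtain D :: "'x set" where D: "countable D" "\<And>X. open X \<Longrightarrow> X \<noteq> {} \<Longrightarrow> \<exists>d\<in>D. d \<in> X"
    by (rule countable_dense_setE) auto
  have "closure D = UNIV"
    using D(2)[of "- closure D"] closure_subset[of D] by (auto simp: open_Compl)
  then have "separable_space (euclidean :: 'x topology)"
    unfolding separable_space_def using D(1) by (intro exI[of _ D]) auto
  then show ?thesis
    unfolding standard_borel_def sp assms
    by (intro exI[of _ euclidean]) (auto simp: completely_metrizable_space_euclidean borel_def)
qed

context
  fixes J :: "'x \<Rightarrow> 'y"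
  assumes J: "inj J"
begin

lemma J_eq [simp]: "J x = J y \<longleftrightarrow> x = y"
  using J by (rule inj_eq)

text \<open>\<open>J\<close> is just an injection of sets, so the image receives the topology pulled
  back along its inverse. This makes \<open>J\<close> a homeomorphism onto its image, whatever
  topology the target type carries.\<close>

lemma standard_borel_embed:
  assumes "standard_borel M"
  shows "standard_borel (embed_measure M J)"
proof -
  obtain T where T: "topspace T = space M" "separable_space T" "completely_metrizable_space T"
    "sets M = sigma_sets (space M) {U. openin T U}"
    using assms by (auto simp: standard_borel_def)
  let ?X = "J ` space M" and ?K = "the_inv_into (space M) J"
  have inj: "inj_on J (space M)" using J by (rule inj_on_subset) simp
  define T' where "T' = pullback_topology ?X ?K T"
  have KX: "?K -` topspace T \<inter> ?X = ?X"
    using the_inv_into_f_f[OF inj] T(1) by auto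
  have top: "topspace T' = ?X"
    unfolding T'_def topspace_pullback_topology by (rule KX)
  have "continuous_map T' T ?K"
    unfolding continuous_map_alt top
  proof (intro conjI allI impI)
    fix U assume "openin T U"
    then show "openin T' (?K -` U \<inter> ?X)"
      unfolding T'_def openin_pullback_topology by (intro exI[of _ U]) simp
  next
    show "?K \<in> ?X \<rightarrow> topspace T"
      unfolding T(1) by (rule the_inv_into_in_Pi[OF inj])
  qed
  moreover have "continuous_map T T' J"
    unfolding continuous_map_alt top
  proof (intro conjI allI impI)
    fix U assume "openin T' U"
    then obtain V where V: "openin T V" "U = ?K -` V \<inter> ?X"
      by (auto simp: T'_def openin_pullback_topology)
    then have "J -` U \<inter> topspace T = V"
      using openin_subset[OF V(1)] T(1) by (auto simp: the_inv_into_f_f[OF inj])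
    then show "openin T (J -` U \<inter> topspace T)" using V by simp
  next
    show "J \<in> topspace T \<rightarrow> ?X" unfolding T(1) by simp
  qed
  ultimately have "T homeomorphic_space T'"
    unfolding homeomorphic_space_def homeomorphic_maps_def
    using T(1) top by (intro exI[of _ J] exI[of _ ?K]) (auto simp: the_inv_into_f_f[OF inj])
  then have "separable_space T'" "completely_metrizable_space T'"
    using T homeomorphic_separable_space homeomorphic_completely_metrizable_space by blast+
  moreover have "sets (embed_measure M J) = sigma_sets ?X {U. openin T' U}"
  proof -
    have "sets (embed_measure M J) = {?K -` A \<inter> ?X |A. A \<in> sigma_sets (space M) {U. openin T U}}"
      unfolding sets_embed_eq_vimage_algebra[OF inj] T(4)[symmetric]
      by (rule sets_vimage_algebra2) (auto simp: the_inv_into_f_f[OF inj])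
    also have "\<dots> = sigma_sets ?X {?K -` A \<inter> ?X |A. A \<in> {U. openin T U}}"
      by (rule sigma_sets_vimage_commute) (auto simp: the_inv_into_f_f[OF inj])
    also have "{?K -` A \<inter> ?X |A. A \<in> {U. openin T U}} = {U. openin T' U}"
      by (auto simp: T'_def openin_pullback_topology)
    finally show ?thesis .
  qed
  ultimately show ?thesis
    unfolding standard_borel_def space_embed_measure using top by (intro exI[of _ T']) auto
qed

section \<open>Actions, graphings and cost under an injection\<close>

definition embed_action :: "'x measure \<Rightarrow> ('a \<Rightarrow> 'x \<Rightarrow> 'x) \<Rightarrow> 'a \<Rightarrow> 'y \<Rightarrow> 'y" where
  "embed_action M \<phi> g = restrict (\<lambda>y. J (\<phi> g (the_inv J y))) (J ` space M)"

lemma embed_action_apply: "x \<in> space M \<Longrightarrow> embed_action M \<phi> g (J x) = J (\<phi> g x)"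
  using J by (simp add: embed_action_def the_inv_f_f)

lemma pmp_action_embed:
  assumes "pmp_action G M \<phi>"
  shows "pmp_action G (embed_measure M J) (embed_action M \<phi>)"
proof -
  interpret A: group_action G "space M" \<phi> using assms by (simp add: pmp_action_def)
  interpret group G using A.group_hom group_hom.axioms(1) by blast
  interpret prob_space M using assms by (simp add: pmp_action_def)
  let ?M = "embed_measure M J" and ?\<psi> = "embed_action M \<phi>"
  have m: "\<phi> g \<in> measurable M M" "distr M M (\<phi> g) = M" if "g \<in> carrier G" for g
    using assms that by (auto simp: pmp_action_def)
  have JM [measurable]: "J \<in> measurable M ?M" by (rule measurable_embed_measure2[OF J])
  have \<psi>: "?\<psi> g \<in> measurable ?M ?M" if g: "g \<in> carrier G" for g
  proof (rule measurable_embed_measure1)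
    have "(\<lambda>x. J (\<phi> g x)) \<in> measurable M ?M"
      using m[OF g] by measurable
    then show "(\<lambda>x. ?\<psi> g (J x)) \<in> measurable M ?M"
      by (rule measurable_cong[THEN iffD1, rotated]) (simp add: embed_action_apply)
  qed
  have distr: "distr ?M ?M (?\<psi> g) = ?M" if g: "g \<in> carrier G" for g
  proof -
    have "distr ?M ?M (?\<psi> g) = distr M ?M (?\<psi> g \<circ> J)"
      by (subst (1) embed_measure_eq_distr[OF J]) (rule distr_distr[OF \<psi>[OF g] JM])
    also have "\<dots> = distr M ?M (J \<circ> \<phi> g)"
      by (rule distr_cong) (simp_all add: embed_action_apply)
    also have "\<dots> = distr (distr M M (\<phi> g)) ?M J"
      using m[OF g] by (intro distr_distr[symmetric] JM)
    also have "\<dots> = ?M" using m[OF g] embed_measure_eq_distr[OF J, of M] by simp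
    finally show ?thesis .
  qed
  have into: "\<phi> g x \<in> space M" if "g \<in> carrier G" "x \<in> space M" for g x
    using A.element_image[OF that refl] .
  have "group_action G (J ` space M) ?\<psi>"
  proof (rule group_actionI)
    fix g assume g: "g \<in> carrier G"
    show "?\<psi> g \<in> extensional (J ` space M)" by (simp add: embed_action_def)
    show "?\<psi> g x \<in> J ` space M" if "x \<in> J ` space M" for x
      using that g into by (auto simp: embed_action_apply)
    show "?\<psi> (g \<otimes>\<^bsub>G\<^esub> h) x = ?\<psi> g (?\<psi> h x)" if "h \<in> carrier G" "x \<in> J ` space M" for h x
      using that g into A.composition_rule by (auto simp: embed_action_apply)
  next
    show "?\<psi> \<one>\<^bsub>G\<^esub> x = x" if "x \<in> J ` space M" for x
      using that by (auto simp: embed_action_apply A.id_eq_one[symmetric])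
  qed (rule is_group)
  moreover have "prob_space ?M"
    by (subst embed_measure_eq_distr[OF J]) (rule prob_space_distr[OF JM])
  ultimately show ?thesis
    using assms \<psi> distr standard_borel_embed by (auto simp: pmp_action_def space_embed_measure)
qed

lemma essentially_free_embed:
  assumes "essentially_free G M \<phi>"
  shows "essentially_free G (embed_measure M J) (embed_action M \<phi>)"
proof -
  have "stabilizer G (embed_action M \<phi>) (J x) = stabilizer G \<phi> x" if "x \<in> space M" for x
    using that by (auto simp: stabilizer_def embed_action_apply)
  then show ?thesis
    using assms unfolding essentially_free_def AE_embed_measure[OF J]
    by (auto elim: AE_mp)
qed

lemma rtrancl_map_prod_image:
  "(map_prod J J ` H)\<^sup>* `` {J x} = J ` (H\<^sup>* `` {x})"
proof -
  have "\<exists>y. z = J y \<and> (x, y) \<in> H\<^sup>*" if "(J x, z) \<in> (map_prod J J ` H)\<^sup>*" for z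
    using that
  proof induction
    case (step y z)
    then show ?case by (auto intro: rtrancl_into_rtrancl)
  qed auto
  moreover have "(J x, J y) \<in> (map_prod J J ` H)\<^sup>*" if "(x, y) \<in> H\<^sup>*" for y
    using that
  proof induction
    case (step y z)
    then show ?case by (force intro: rtrancl_into_rtrancl)
  qed auto
  ultimately show ?thesis by auto
qed

lemma orbit_relation_embed:
  "orbit_relation G (embed_measure M J) (embed_action M \<phi>) = map_prod J J ` orbit_relation G M \<phi>"
  by (force simp: orbit_relation_def orbit_def space_embed_measure embed_action_apply)

lemma sets_pair_embed:
  assumes "sigma_finite_measure M"
  shows "sets (embed_measure M J \<Otimes>\<^sub>M embed_measure M J) = (`) (map_prod J J) ` sets (M \<Otimes>\<^sub>M M)"
proof -
  have "(\<lambda>(x, y). (J x, J y)) = map_prod J J" by (auto simp: map_prod_def)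
  then show ?thesis
    unfolding embed_measure_prod[OF J J assms assms]
    using sets_embed_measure_alt[OF prod.inj_map[OF J J]] by simp
qed

lemma graphings_embed:
  assumes "sigma_finite_measure M"
  shows "graphings (embed_measure M J) (map_prod J J ` R) = (`) (map_prod J J) ` graphings M R"
proof -
  have JJ: "inj (map_prod J J)" by (rule prod.inj_map[OF J J])
  have img: "(map_prod J J ` R) `` {J x} = J ` (R `` {x})" for R :: "('x \<times> 'x) set" and x
    by force
  have iff: "map_prod J J ` H \<in> graphings (embed_measure M J) (map_prod J J ` R) \<longleftrightarrow> H \<in> graphings M R"
    if "H \<in> sets (M \<Otimes>\<^sub>M M)" for H
  proof -
    have "sym (map_prod J J ` H) \<longleftrightarrow> sym H"
      by (force simp: sym_def)
    moreover have "irrefl (map_prod J J ` H) \<longleftrightarrow> irrefl H"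
      by (force simp: irrefl_def)
    moreover have "map_prod J J ` H \<subseteq> map_prod J J ` R \<longleftrightarrow> H \<subseteq> R"
      by (rule inj_image_subset_iff[OF JJ])
    ultimately show ?thesis
      using that unfolding graphings_def sets_pair_embed[OF assms] AE_embed_measure[OF J]
      by (auto simp: rtrancl_map_prod_image img inj_image_eq_iff[OF J])
  qed
  have img': "H' \<in> (`) (map_prod J J) ` sets (M \<Otimes>\<^sub>M M)"
    if "H' \<in> graphings (embed_measure M J) (map_prod J J ` R)" for H'
    using that by (simp add: graphings_def sets_pair_embed[OF assms])
  show ?thesis
  proof (intro equalityI subsetI)
    fix H' assume H': "H' \<in> graphings (embed_measure M J) (map_prod J J ` R)"
    from img'[OF H'] obtain H where "H \<in> sets (M \<Otimes>\<^sub>M M)" "H' = map_prod J J ` H" by auto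
    with H' iff show "H' \<in> (`) (map_prod J J) ` graphings M R" by auto
  next
    fix H' assume "H' \<in> (`) (map_prod J J) ` graphings M R"
    then obtain H where "H \<in> graphings M R" "H' = map_prod J J ` H" by auto
    then show "H' \<in> graphings (embed_measure M J) (map_prod J J ` R)"
      using iff by (simp add: graphings_def)
  qed
qed

lemma graph_degree_embed: "graph_degree (map_prod J J ` H) (J x) = graph_degree H x"
proof -
  have "(map_prod J J ` H) `` {J x} = J ` (H `` {x})"
    by force
  moreover have "emeasure (count_space UNIV) (J ` A) = emeasure (count_space UNIV) A" for A :: "'x set"
    using inj_on_subset[OF J subset_UNIV, of A]
    by (simp add: emeasure_count_space finite_image_iff card_image)
  ultimately show ?thesis by (simp add: graph_degree_def)
qed

text \<open>Degree functions are not known to be measurable, so this version of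
  \<open>nn_integral_embed_measure\<close> does without.\<close>

lemma nn_integral_embed_measure_all:
  "(\<integral>\<^sup>+y. f y \<partial>embed_measure M J) = (\<integral>\<^sup>+x. f (J x) \<partial>M)"
proof (rule antisym)
  show "(\<integral>\<^sup>+y. f y \<partial>embed_measure M J) \<le> (\<integral>\<^sup>+x. f (J x) \<partial>M)"
    unfolding nn_integral_def[of "embed_measure M J"]
  proof (rule SUP_least, clarify)
    fix g assume g: "simple_function (embed_measure M J) g" "g \<le> f"
    have "integral\<^sup>S (embed_measure M J) g = (\<integral>\<^sup>+y. g y \<partial>embed_measure M J)"
      by (rule nn_integral_eq_simple_integral[OF g(1), symmetric])
    also have "\<dots> = (\<integral>\<^sup>+x. g (J x) \<partial>M)"
      by (rule nn_integral_embed_measure[OF J borel_measurable_simple_function[OF g(1)]])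
    also have "\<dots> \<le> (\<integral>\<^sup>+x. f (J x) \<partial>M)"
      using g(2) by (intro nn_integral_mono) (auto simp: le_fun_def)
    finally show "integral\<^sup>S (embed_measure M J) g \<le> (\<integral>\<^sup>+x. f (J x) \<partial>M)" .
  qed
  show "(\<integral>\<^sup>+x. f (J x) \<partial>M) \<le> (\<integral>\<^sup>+y. f y \<partial>embed_measure M J)"
    unfolding nn_integral_def[of M]
  proof (rule SUP_least, clarify)
    fix g :: "'x \<Rightarrow> ennreal" assume g: "simple_function M g" "g \<le> (\<lambda>x. f (J x))"
    define g' where "g' y = (if y \<in> range J then g (the_inv J y) else 0)" for y
    have g'J: "g' (J x) = g x" for x using J by (simp add: g'_def the_inv_f_f)
    have g': "g' \<in> borel_measurable (embed_measure M J)"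
      using borel_measurable_simple_function[OF g(1)]
      by (intro measurable_embed_measure1) (simp add: g'J)
    have "integral\<^sup>S M g = (\<integral>\<^sup>+x. g' (J x) \<partial>M)"
      unfolding g'J by (rule nn_integral_eq_simple_integral[OF g(1), symmetric])
    also have "\<dots> = (\<integral>\<^sup>+y. g' y \<partial>embed_measure M J)"
      by (rule nn_integral_embed_measure[OF J g', symmetric])
    also have "\<dots> \<le> (\<integral>\<^sup>+y. f y \<partial>embed_measure M J)"
      using g(2) J by (intro nn_integral_mono) (auto simp: g'_def le_fun_def the_inv_f_f)
    finally show "integral\<^sup>S M g \<le> (\<integral>\<^sup>+y. f y \<partial>embed_measure M J)" .
  qed
qed

lemma cost_embed:
  assumes "sigma_finite_measure M"
  shows "cost G (embed_measure M J) (embed_action M \<phi>) = cost G M \<phi>"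
  unfolding cost_def orbit_relation_embed graphings_embed[OF assms] nn_integral_embed_measure_all
  by (simp add: image_image graph_degree_embed)

end

text \<open>\<open>fixed_price\<close> speaks of real points only; an injection of the point type
  makes it available for sequences of labels and for their products.\<close>

lemma fixed_price_cost:
  fixes M :: "'x measure" and J :: "'x \<Rightarrow> real"
  assumes "fixed_price G c" "inj J" "pmp_action G M \<phi>" "essentially_free G M \<phi>"
  shows "cost G M \<phi> = ereal c"
proof -
  interpret prob_space M using assms(3) by (simp add: pmp_action_def)
  have "cost G (embed_measure M J) (embed_action J M \<phi>) = ereal c"
    using assms(1) pmp_action_embed[OF assms(2,3)] essentially_free_embed[OF assms(2,4)]
    unfolding fixed_price_def by simp
  then show ?thesis
    using cost_embed[OF assms(2)] sigma_finite_measure_axioms by metis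
qed

text \<open>A real is coded by a set of naturals, and a sequence of such sets by a single one
  through the pairing of naturals. The separate real component is placed in front of the
  sequence.\<close>

lemma inj_seq_to_real: "\<exists>J :: (nat \<Rightarrow> real) \<times> real \<Rightarrow> real. inj J"
proof -
  obtain e :: "real \<Rightarrow> nat set" and d :: "nat set \<Rightarrow> real" where ed: "inj e" "inj d"
    using nat_sets_eqpoll_reals by (meson eqpoll_imp_lepoll eqpoll_sym lepoll_def)
  define f :: "(nat \<Rightarrow> real) \<times> real \<Rightarrow> nat \<Rightarrow> real" where "f p = case_nat (snd p) (fst p)" for p
  define k where "k p = {z. snd (prod_decode z) \<in> e (f p (fst (prod_decode z)))}" for p
  have "inj k"
  proof (rule injI)
    fix p q assume eq: "k p = k q"
    have "e (f p n) = e (f q n)" for n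
      unfolding set_eq_iff
    proof
      fix i
      have "prod_encode (n, i) \<in> k p \<longleftrightarrow> prod_encode (n, i) \<in> k q" using eq by simp
      then show "i \<in> e (f p n) \<longleftrightarrow> i \<in> e (f q n)" by (simp add: k_def)
    qed
    then have f: "f p n = f q n" for n
      using ed(1) by (simp add: inj_eq)
    have "snd p = snd q" using f[of 0] by (simp add: f_def)
    moreover have "fst p m = fst q m" for m using f[of "Suc m"] by (simp add: f_def)
    ultimately show "p = q" by (auto simp: prod_eq_iff)
  qed
  then have "inj (d \<circ> k)" using ed(2) by (simp add: inj_compose)
  then show ?thesis by blast
qed

section \<open>Independent uniform labels\<close>

abbreviation uniform01 :: "real measure" where
  "uniform01 \<equiv> uniform_measure lborel {0..1}"

lemma prob_space_uniform01: "prob_space uniform01"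
  by (rule prob_space_uniform_measure) auto

lemma AE_uniform01_neq: "AE x in uniform01. x \<noteq> r"
  by (rule AE_uniform_measureI) (auto intro: AE_mp[OF AE_lborel_singleton[of r]])

abbreviation iid :: "('i \<Rightarrow> real) measure" where
  "iid \<equiv> Pi\<^sub>M UNIV (\<lambda>_. uniform01)"

lemma prob_space_iid: "prob_space iid"
  by (rule prob_space_PiM) (rule prob_space_uniform01)

lemma space_iid [simp]: "space iid = UNIV"
  by (simp add: space_PiM)

lemma sets_iid: "sets (iid :: ('i::countable \<Rightarrow> real) measure) = sets borel"
proof -
  have "sets (iid :: ('i \<Rightarrow> real) measure) = sets (Pi\<^sub>M UNIV (\<lambda>_. borel))"
    by (rule sets_PiM_cong) auto
  then show ?thesis by (simp add: sets_PiM_equal_borel)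
qed

lemma measurable_iid_comp: "(\<lambda>y. y \<circ> \<kappa>) \<in> measurable iid iid"
  unfolding comp_def by (rule measurable_PiM_single') auto

lemma distr_iid_bij:
  assumes "bij \<kappa>"
  shows "distr iid iid (\<lambda>y. y \<circ> \<kappa>) = iid"
  using distr_PiM_reindex[of UNIV "\<lambda>_. uniform01" \<kappa> UNIV] assms prob_space_uniform01
  by (simp add: bij_is_inj comp_def restrict_UNIV)

lemma AE_iid_neq:
  assumes "i \<noteq> j"
  shows "AE x in iid. x i \<noteq> x j"
proof -
  interpret U: prob_space uniform01 by (rule prob_space_uniform01)
  interpret I: prob_space "iid :: ('a \<Rightarrow> real) measure" by (rule prob_space_iid)
  interpret pair_sigma_finite uniform01 "iid :: ('a \<Rightarrow> real) measure" ..
  let ?f = "\<lambda>(r, x). (x :: 'a \<Rightarrow> real)(i := r)"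
  \<comment> \<open>Redrawing coordinate \<open>i\<close> independently leaves the law unchanged; a
    fresh atomless value almost surely avoids the given value at \<open>j\<close>.\<close>
  have eq: "iid = distr (uniform01 \<Otimes>\<^sub>M iid) iid ?f"
    using distr_pair_PiM_eq_PiM[of UNIV "\<lambda>_. uniform01" i] prob_space_uniform01 by simp
  have "AE z in uniform01 \<Otimes>\<^sub>M iid. fst z \<noteq> snd z j"
  proof (rule AE_pair_measure)
    show "{z \<in> space (uniform01 \<Otimes>\<^sub>M iid). fst z \<noteq> snd z j} \<in> sets (uniform01 \<Otimes>\<^sub>M iid)"
    proof (rule borel_measurable_neq)
      show "fst \<in> borel_measurable (uniform01 \<Otimes>\<^sub>M (iid :: ('a \<Rightarrow> real) measure))"
        using measurable_fst[of uniform01 "iid :: ('a \<Rightarrow> real) measure"] by simp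
      show "(\<lambda>z. snd z j) \<in> borel_measurable (uniform01 \<Otimes>\<^sub>M (iid :: ('a \<Rightarrow> real) measure))"
        using measurable_compose[OF measurable_snd measurable_component_singleton[of j UNIV "\<lambda>_. uniform01"],
            of uniform01] by simp
    qed
    show "AE r in uniform01. AE x in iid. fst (r, x) \<noteq> snd (r, x) j"
    proof (rule AE_I2)
      fix r
      show "AE x in iid. fst (r, x) \<noteq> snd (r, x :: 'a \<Rightarrow> real) j"
        using AE_PiM_component[of UNIV "\<lambda>_. uniform01" j "\<lambda>t. t \<noteq> r", OF prob_space_uniform01 _ AE_uniform01_neq]
        by (simp add: eq_commute)
    qed
  qed
  then have "AE z in uniform01 \<Otimes>\<^sub>M iid. ?f z i \<noteq> ?f z j"
    using assms by (auto simp: case_prod_beta)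
  moreover have "(\<lambda>x. x k) \<in> borel_measurable (iid :: ('a \<Rightarrow> real) measure)" for k
    using measurable_component_singleton[of k UNIV "\<lambda>_. uniform01"] by simp
  then have "{x \<in> space iid. x i \<noteq> x j} \<in> sets (iid :: ('a \<Rightarrow> real) measure)"
    by (intro borel_measurable_neq)
  ultimately show ?thesis
    by (subst eq, subst AE_distr_iff) (auto intro!: measurable_fun_upd[of _ UNIV] simp: measurable_split_conv)
qed

lemma AE_iid_inj: "AE x in (iid :: ('i::countable \<Rightarrow> real) measure). inj x"
proof -
  have "AE x in (iid :: ('i \<Rightarrow> real) measure). \<forall>i j. i \<noteq> j \<longrightarrow> x i \<noteq> x j"
    unfolding AE_all_countable using AE_iid_neq by auto
  then show ?thesis by eventually_elim (auto simp: inj_def)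
qed

section \<open>Cylinder sets\<close>

definition cylinders :: "(nat \<Rightarrow> real) set set" where
  "cylinders = {B \<in> sets iid. \<exists>D. finite D \<and> (\<forall>x y. (\<forall>n\<in>D. x n = y n) \<longrightarrow> x \<in> B \<longrightarrow> y \<in> B)}"

lemma cylinders_sets: "B \<in> cylinders \<Longrightarrow> B \<in> sets iid"
  by (simp add: cylinders_def)

lemma cylinders_empty: "{} \<in> cylinders"
  by (auto simp: cylinders_def)

lemma cylinders_Compl: "B \<in> cylinders \<Longrightarrow> - B \<in> cylinders"
  using sets.compl_sets[of B iid] by (auto simp: cylinders_def Compl_eq_Diff_UNIV) metis

lemma cylinders_Un:
  assumes "A \<in> cylinders" "B \<in> cylinders"
  shows "A \<union> B \<in> cylinders"
proof -
  obtain D E where "finite D" "\<forall>x y. (\<forall>n\<in>D. x n = y n) \<longrightarrow> x \<in> A \<longrightarrow> y \<in> A"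
      "finite E" "\<forall>x y. (\<forall>n\<in>E. x n = y n) \<longrightarrow> x \<in> B \<longrightarrow> y \<in> B"
    using assms by (auto simp: cylinders_def)
  then have "finite (D \<union> E) \<and> (\<forall>x y. (\<forall>n\<in>D \<union> E. x n = y n) \<longrightarrow> x \<in> A \<union> B \<longrightarrow> y \<in> A \<union> B)"
    by (metis UnCI UnE finite_UnI)
  then show ?thesis
    using assms unfolding cylinders_def by blast
qed

lemma cylinders_Int: "A \<in> cylinders \<Longrightarrow> B \<in> cylinders \<Longrightarrow> A \<inter> B \<in> cylinders"
  using cylinders_Compl[OF cylinders_Un[OF cylinders_Compl cylinders_Compl, of A B]] by simp

lemma cylinders_UN: "finite I \<Longrightarrow> (\<And>i. i \<in> I \<Longrightarrow> A i \<in> cylinders) \<Longrightarrow> (\<Union>i\<in>I. A i) \<in> cylinders"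
  by (induction I rule: finite_induct) (auto simp: cylinders_empty cylinders_Un)

lemma cylinders_INT:
  assumes "finite I" "\<And>i. i \<in> I \<Longrightarrow> A i \<in> cylinders"
  shows "(\<Inter>i\<in>I. A i) \<in> cylinders"
  using cylinders_Compl[OF cylinders_UN[of I "\<lambda>i. - A i"]] assms cylinders_Compl by simp

lemma cylinders_vimage:
  assumes "B \<in> cylinders"
  shows "(\<lambda>x. x \<circ> \<kappa>) -` B \<in> cylinders"
proof -
  obtain D where "finite D" "\<forall>x y. (\<forall>n\<in>D. x n = y n) \<longrightarrow> x \<in> B \<longrightarrow> y \<in> B"
    using assms by (auto simp: cylinders_def)
  then have "finite (\<kappa> ` D) \<and> (\<forall>x y. (\<forall>n\<in>\<kappa> ` D. x n = y n) \<longrightarrow>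
      x \<in> (\<lambda>x. x \<circ> \<kappa>) -` B \<longrightarrow> y \<in> (\<lambda>x. x \<circ> \<kappa>) -` B)"
    by simp (metis comp_apply)
  moreover have "(\<lambda>x. x \<circ> \<kappa>) -` B \<in> sets iid"
    using measurable_sets[OF measurable_iid_comp cylinders_sets[OF assms], of \<kappa>] by simp
  ultimately show ?thesis unfolding cylinders_def by blast
qed

lemma cylinders_coordinate:
  assumes "A \<in> sets borel" shows "{x. x n \<in> A} \<in> cylinders"
proof -
  have "(\<lambda>x. x n) -` A \<inter> space iid \<in> sets (iid :: (nat \<Rightarrow> real) measure)"
    by (rule measurable_sets[of _ _ uniform01]) (use assms in auto)
  then show ?thesis
    by (auto simp: cylinders_def vimage_def intro!: exI[of _ "{n}"])
qed

text \<open>Distinct coordinates of an independent family are again independent and uniform, so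
  reading them along \<open>\<kappa>\<close> changes nothing as long as \<open>\<kappa>\<close> is
  injective on the coordinates that \<open>B\<close> looks at. Both sides equal the measure of the
  trace of \<open>B\<close> on \<open>D\<close>. This replaces measure preservation on the finite
  coset spaces.\<close>

lemma cylinder_window_measure:
  fixes \<kappa> :: "nat \<Rightarrow> 'i"
  assumes B: "B \<in> sets iid" and D: "\<And>x y. (\<And>n. n \<in> D \<Longrightarrow> x n = y n) \<Longrightarrow> x \<in> B \<Longrightarrow> y \<in> B"
    and \<kappa>: "inj_on \<kappa> D"
  shows "emeasure iid ((\<lambda>y. y \<circ> \<kappa>) -` B) = emeasure iid B"
proof -
  \<comment> \<open>The filling value 0 is arbitrary: membership in \<open>B\<close> is decided on
    \<open>D\<close>.\<close>
  let ?ext = "\<lambda>z n. if n \<in> D then z n else (0::real)"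
  let ?B = "?ext -` B \<inter> space (Pi\<^sub>M D (\<lambda>_. uniform01))"
  have "?ext \<in> measurable (Pi\<^sub>M D (\<lambda>_. uniform01)) iid"
  proof (rule measurable_PiM_single')
    show "(\<lambda>z. if n \<in> D then z n else 0) \<in> measurable (Pi\<^sub>M D (\<lambda>_. uniform01)) uniform01" for n
      by (cases "n \<in> D") auto
  qed auto
  then have B': "?B \<in> sets (Pi\<^sub>M D (\<lambda>_. uniform01))" using B by (rule measurable_sets)
  have "emeasure iid ((\<lambda>y. y \<circ> \<kappa>) -` B) = emeasure (Pi\<^sub>M D (\<lambda>_. uniform01)) ?B"
    if "inj_on \<kappa> D" for \<kappa> :: "nat \<Rightarrow> 'j"
  proof -
    let ?r = "\<lambda>\<omega>. \<lambda>n\<in>D. \<omega> (\<kappa> n)"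
    have r: "?r \<in> measurable iid (Pi\<^sub>M D (\<lambda>_. uniform01))" by measurable
    have "emeasure (Pi\<^sub>M D (\<lambda>_. uniform01)) ?B = emeasure (distr iid (Pi\<^sub>M D (\<lambda>_. uniform01)) ?r) ?B"
      using distr_PiM_reindex[of UNIV "\<lambda>_. uniform01" \<kappa> D] that prob_space_uniform01 by simp
    also have "\<dots> = emeasure iid (?r -` ?B \<inter> space iid)"
      by (rule emeasure_distr[OF r B'])
    also have "?r -` ?B \<inter> space iid = (\<lambda>y. y \<circ> \<kappa>) -` B"
    proof -
      have "?ext (?r y) \<in> B \<longleftrightarrow> y \<circ> \<kappa> \<in> B" for y
        using D[of "?ext (?r y)" "y \<circ> \<kappa>"] D[of "y \<circ> \<kappa>" "?ext (?r y)"] by auto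
      then show ?thesis by (auto simp: space_PiM)
    qed
    finally show ?thesis by simp
  qed
  from this[OF \<kappa>] this[of id] show ?thesis by (simp add: comp_def)
qed

section \<open>Approximation of measurable sets by cylinders\<close>

definition approximable :: "(nat \<Rightarrow> real) set \<Rightarrow> bool" where
  "approximable A \<longleftrightarrow>
     (\<forall>\<epsilon>>0. \<exists>B\<in>cylinders. measure iid (A - B) < \<epsilon> \<and> measure iid (B - A) < \<epsilon>)"

text \<open>The approximable sets contain the sets given by one coordinate and are closed under
  complements and countable unions, the latter by truncating the union and approximating the
  finitely many remaining pieces.\<close>

lemma approximable_sets:
  assumes "A \<in> sets iid"
  shows "approximable A"
proof -
  interpret prob_space "iid :: (nat \<Rightarrow> real) measure" by (rule prob_space_iid)
  have "A \<in> sigma_sets UNIV {{f. f i \<in> A} | (i::nat) A. A \<in> sets (borel :: real measure)}"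
    using assms unfolding sets_PiM_single by (simp add: PiE_UNIV_domain)
  then show ?thesis
  proof induction
    case (Basic A)
    then have "A \<in> cylinders" using cylinders_coordinate by auto
    then show ?case by (auto simp: approximable_def intro!: bexI[of _ A])
  next
    case Empty
    then show ?case by (auto simp: approximable_def intro!: bexI[of _ "{}"] cylinders_empty)
  next
    case (Compl A)
    show ?case unfolding approximable_def
    proof (intro allI impI)
      fix \<epsilon> :: real assume "\<epsilon> > 0"
      then obtain B where B: "B \<in> cylinders" "prob (A - B) < \<epsilon>" "prob (B - A) < \<epsilon>"
        using Compl by (auto simp: approximable_def)
      moreover have "(UNIV - A) - (- B) = B - A" "(- B) - (UNIV - A) = A - B" by auto
      ultimately show "\<exists>B\<in>cylinders. prob (UNIV - A - B) < \<epsilon> \<and> prob (B - (UNIV - A)) < \<epsilon>"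
        by (intro bexI[of _ "- B"]) (auto simp: cylinders_Compl)
    qed
  next
    case (Union A)
    have sets: "A i \<in> events" for i
      using Union.hyps unfolding sets_PiM_single by (simp add: PiE_UNIV_domain)
    show ?case unfolding approximable_def
    proof (intro allI impI)
      fix \<epsilon> :: real assume \<epsilon>: "\<epsilon> > 0"
      have "(\<lambda>n. prob (\<Union>i<n. A i)) \<longlonglongrightarrow> prob (\<Union>n. \<Union>i<n. A i)"
        by (rule finite_Lim_measure_incseq) (use sets in \<open>auto simp: incseq_def intro: less_le_trans\<close>)
      moreover have "(\<Union>n. \<Union>i<n. A i) = (\<Union>i. A i)" by auto
      ultimately have "eventually (\<lambda>n. prob (\<Union>i. A i) - \<epsilon> / 2 < prob (\<Union>i<n. A i)) sequentially"
        using \<epsilon> by (intro order_tendstoD(1)) auto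
      then obtain n where n: "prob (\<Union>i. A i) - \<epsilon> / 2 < prob (\<Union>i<n. A i)"
        by (auto simp: eventually_sequentially)
      \<comment> \<open>One half of \<open>\<epsilon>\<close> pays for the truncated tail, the other
        for \<open>n\<close> approximations; the added 1 covers \<open>n = 0\<close>.\<close>
      define \<eta> where "\<eta> = \<epsilon> / 2 / (real n + 1)"
      have \<eta>: "\<eta> > 0" "real n * \<eta> < \<epsilon> / 2" using \<epsilon> by (auto simp: \<eta>_def field_simps)
      have "\<exists>B. B \<in> cylinders \<and> prob (A i - B) < \<eta> \<and> prob (B - A i) < \<eta>" for i
        using Union.IH[of i] \<eta>(1) unfolding approximable_def by blast
      then obtain B where B: "\<And>i. B i \<in> cylinders \<and> prob (A i - B i) < \<eta> \<and> prob (B i - A i) < \<eta>"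
        by metis
      have Bs: "B i \<in> events" for i using B cylinders_sets by auto
      let ?C = "\<Union>i<n. B i"
      have small: "prob (\<Union>i<n. X i) < \<epsilon> / 2"
        if X: "\<And>i. X i \<in> events" "\<And>i. prob (X i) < \<eta>" for X
      proof -
        have "prob (\<Union>i<n. X i) \<le> (\<Sum>i<n. prob (X i))"
          using X by (intro finite_measure_subadditive_finite) auto
        also have "\<dots> \<le> (\<Sum>i<n. \<eta>)" using X by (intro sum_mono) (simp add: less_imp_le)
        also have "\<dots> < \<epsilon> / 2" using \<eta> by simp
        finally show ?thesis .
      qed
      have "prob (?C - (\<Union>i. A i)) \<le> prob (\<Union>i<n. B i - A i)"
        using sets Bs by (intro finite_measure_mono) auto
      also have "\<dots> < \<epsilon> / 2" using B Bs sets by (intro small) auto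
      finally have 1: "prob (?C - (\<Union>i. A i)) < \<epsilon>" using \<epsilon> by simp
      have "prob ((\<Union>i. A i) - ?C) \<le> prob (((\<Union>i. A i) - (\<Union>i<n. A i)) \<union> (\<Union>i<n. A i - B i))"
        using sets Bs by (intro finite_measure_mono) auto
      also have "\<dots> \<le> prob ((\<Union>i. A i) - (\<Union>i<n. A i)) + prob (\<Union>i<n. A i - B i)"
        using sets Bs by (intro measure_Un_le) auto
      also have "prob ((\<Union>i. A i) - (\<Union>i<n. A i)) = prob (\<Union>i. A i) - prob (\<Union>i<n. A i)"
        using sets by (intro finite_measure_Diff) auto
      also have "prob (\<Union>i<n. A i - B i) < \<epsilon> / 2"
        using B Bs sets by (intro small) auto
      finally have "prob ((\<Union>i. A i) - ?C) < \<epsilon>" using n by simp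
      moreover have "?C \<in> cylinders" using B by (intro cylinders_UN) auto
      ultimately show "\<exists>B\<in>cylinders. prob (\<Union> (range A) - B) < \<epsilon> \<and> prob (B - \<Union> (range A)) < \<epsilon>"
        using 1 by (intro bexI[of _ ?C]) auto
    qed
  qed
qed

section \<open>The Bernoulli shift\<close>

abbreviation bernoulli :: "(nat \<Rightarrow> real) measure" where
  "bernoulli \<equiv> iid"

locale countable_group = group G for G (structure) +
  assumes countable_carrier: "countable (carrier G)"
begin

text \<open>Indexing labels by naturals instead of group elements gives one Polish type for every
  countable carrier; \<open>site g\<close> is the coordinate holding the label at
  \<open>g\<close>.\<close>

definition site :: "'a \<Rightarrow> nat" where
  "site = to_nat_on (carrier G)"

text \<open>Coordinates that are not the site of a group element are left fixed.\<close>

definition shift_index :: "'a \<Rightarrow> nat \<Rightarrow> nat" where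
  "shift_index g n =
     (if n \<in> site ` carrier G then site (inv g \<otimes> the_inv_into (carrier G) site n) else n)"

definition shift :: "'a \<Rightarrow> (nat \<Rightarrow> real) \<Rightarrow> (nat \<Rightarrow> real)" where
  "shift g x = x \<circ> shift_index g"

lemma inj_on_site: "inj_on site (carrier G)"
  unfolding site_def by (rule inj_on_to_nat_on[OF countable_carrier])

lemma shift_index_site [simp]:
  "g \<in> carrier G \<Longrightarrow> h \<in> carrier G \<Longrightarrow> shift_index g (site h) = site (inv g \<otimes> h)"
  by (simp add: shift_index_def the_inv_into_f_f[OF inj_on_site])

lemma shift_index_other: "n \<notin> site ` carrier G \<Longrightarrow> shift_index g n = n"
  by (simp add: shift_index_def)

lemma shift_index_mult:
  assumes "g \<in> carrier G" "h \<in> carrier G"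
  shows "shift_index h (shift_index g n) = shift_index (g \<otimes> h) n"
proof (cases "n \<in> site ` carrier G")
  case True
  then show ?thesis using assms by (auto simp: inv_mult_group m_assoc)
qed (simp add: shift_index_other)

lemma shift_index_one: "shift_index \<one> n = n"
proof (cases "n \<in> site ` carrier G")
  case True
  then show ?thesis by auto
qed (simp add: shift_index_other)

lemma bij_shift_index: "g \<in> carrier G \<Longrightarrow> bij (shift_index g)"
  by (rule bij_betw_byWitness[where f' = "shift_index (inv g)"])
    (auto simp: shift_index_mult shift_index_one)

lemma shift_mult: "g \<in> carrier G \<Longrightarrow> h \<in> carrier G \<Longrightarrow> shift (g \<otimes> h) x = shift g (shift h x)"
  by (simp add: shift_def fun_eq_iff shift_index_mult)

lemma shift_one: "shift \<one> x = x"
  by (simp add: shift_def fun_eq_iff shift_index_one)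

lemma shift_measurable [measurable]: "shift g \<in> measurable bernoulli bernoulli"
  unfolding shift_def by (rule measurable_iid_comp)

lemma distr_shift: "g \<in> carrier G \<Longrightarrow> distr bernoulli bernoulli (shift g) = bernoulli"
  unfolding shift_def by (rule distr_iid_bij) (rule bij_shift_index)

lemma group_action_shift: "group_action G UNIV shift"
  by (rule group_actionI) (simp_all add: is_group shift_one shift_mult)

lemma shift_fixed_point:
  assumes "inj x" "g \<in> carrier G" "shift g x = x"
  shows "g = \<one>"
proof -
  have "x (site (inv g \<otimes> \<one>)) = x (site \<one>)"
    using fun_cong[OF assms(3), of "site \<one>"] assms(2) by (simp add: shift_def)
  then have "site (inv g) = site \<one>" using assms(1,2) by (auto dest: injD)
  then have "inv g = \<one>" using inj_on_site assms(2) by (auto dest: inj_onD)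
  then show ?thesis using assms(2) by (metis inv_inv inv_one)
qed

lemma pmp_action_shift: "pmp_action G bernoulli shift"
  unfolding pmp_action_def
  by (auto simp: standard_borel_borel sets_iid prob_space_iid group_action_shift distr_shift)

lemma essentially_free_shift: "essentially_free G bernoulli shift"
  unfolding essentially_free_def
  using AE_iid_inj
proof eventually_elim
  case (elim x)
  then show ?case using shift_fixed_point shift_one by (auto simp: stabilizer_def)
qed

text \<open>The diagonal action with an arbitrary action on labels is free because the shift is.\<close>

definition labelled_shift :: "('a \<Rightarrow> real \<Rightarrow> real) \<Rightarrow> 'a \<Rightarrow> (nat \<Rightarrow> real) \<times> real \<Rightarrow> (nat \<Rightarrow> real) \<times> real" where
  "labelled_shift \<psi> g = (\<lambda>(x, r). (shift g x, \<psi> g r))"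

lemma pmp_action_labelled_shift:
  assumes L: "prob_space L" "sets L = sets borel" and act: "group_action G UNIV \<psi>"
    and \<psi>: "\<And>g. g \<in> carrier G \<Longrightarrow> \<psi> g \<in> measurable L L"
    and distr: "\<And>g. g \<in> carrier G \<Longrightarrow> distr L L (\<psi> g) = L"
  shows "pmp_action G (bernoulli \<Otimes>\<^sub>M L) (labelled_shift \<psi>)"
proof -
  interpret L: prob_space L by fact
  interpret I: prob_space bernoulli by (rule prob_space_iid)
  interpret P: pair_prob_space bernoulli L ..
  interpret A: group_action G UNIV \<psi> by fact
  have sets: "sets (bernoulli \<Otimes>\<^sub>M L) = sets (borel :: ((nat \<Rightarrow> real) \<times> real) measure)"
    using sets_pair_measure_cong[OF sets_iid L(2)] unfolding borel_prod .
  have sp: "space (bernoulli \<Otimes>\<^sub>M L) = UNIV" using sets_eq_imp_space_eq[OF sets] by simp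
  have "group_action G UNIV (labelled_shift \<psi>)"
  proof (rule group_actionI)
    show "labelled_shift \<psi> \<one> x = x" for x
      using A.id_eq_one by (auto simp: labelled_shift_def shift_one split: prod.splits) (metis UNIV_I restrict_apply')
  qed (auto simp: is_group labelled_shift_def shift_mult A.composition_rule)
  moreover have "labelled_shift \<psi> g \<in> measurable (bernoulli \<Otimes>\<^sub>M L) (bernoulli \<Otimes>\<^sub>M L)" if "g \<in> carrier G" for g
    using \<psi>[OF that] unfolding labelled_shift_def by measurable
  moreover have "distr (bernoulli \<Otimes>\<^sub>M L) (bernoulli \<Otimes>\<^sub>M L) (labelled_shift \<psi> g) = bernoulli \<Otimes>\<^sub>M L" if g: "g \<in> carrier G" for g
    using pair_measure_distr[OF shift_measurable \<psi>[OF g], of g] L.sigma_finite_measure_axioms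
    unfolding distr[OF g] distr_shift[OF g] labelled_shift_def by simp
  ultimately show ?thesis
    unfolding pmp_action_def using sp sets P.prob_space_axioms by (simp add: standard_borel_borel)
qed

lemma essentially_free_labelled_shift:
  assumes "prob_space L" "group_action G UNIV \<psi>"
  shows "essentially_free G (bernoulli \<Otimes>\<^sub>M L) (labelled_shift \<psi>)"
proof -
  interpret L: prob_space L by fact
  interpret I: prob_space bernoulli by (rule prob_space_iid)
  interpret P: pair_prob_space bernoulli L ..
  interpret A: group_action G UNIV \<psi> by fact
  have "AE z in bernoulli \<Otimes>\<^sub>M L. inj (fst z)"
  proof (rule AE_distrD[where f = fst and P = inj and M' = bernoulli])
    show "fst \<in> measurable (bernoulli \<Otimes>\<^sub>M L) bernoulli" by (rule measurable_fst)
    show "AE x in distr (bernoulli \<Otimes>\<^sub>M L) bernoulli fst. inj x"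
      unfolding L.distr_pair_fst by (rule AE_iid_inj)
  qed
  then show ?thesis unfolding essentially_free_def
  proof eventually_elim
    case (elim z)
    have "\<psi> \<one> r = r" for r using A.id_eq_one by (metis UNIV_I restrict_apply')
    with elim show ?case
      using shift_fixed_point[of "fst z"]
      by (cases z) (auto simp: stabilizer_def labelled_shift_def shift_one)
  qed
qed

end

section \<open>Bounding the cost by an explicit graph\<close>

text \<open>Each set \<open>A i\<close> adds to the degree at \<open>x\<close> and at its translate,
  and by invariance both contributions integrate to the measure of \<open>A i\<close>; the factor
  one half in the cost cancels this doubling. In \<open>conn\<close> the edges are only required to
  lie in \<open>E\<^sup>*\<close>, because \<open>\<phi> (\<gamma> i)\<close> may fix points and a
  graphing has no loops.\<close>

lemma cost_le_edges:
  fixes M :: "'x::{second_countable_topology, t2_space} measure" and A :: "'i \<Rightarrow> 'x set"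
  assumes act: "pmp_action G M \<phi>" and sets: "sets M = sets borel"
    and I: "finite I" "\<And>i. i \<in> I \<Longrightarrow> A i \<in> sets M" "\<And>i. i \<in> I \<Longrightarrow> \<gamma> i \<in> carrier G"
    and conn: "\<And>E. sym E \<Longrightarrow> (\<And>x i. i \<in> I \<Longrightarrow> x \<in> A i \<Longrightarrow> (x, \<phi> (\<gamma> i) x) \<in> E\<^sup>*) \<Longrightarrow>
      AE x in M. \<forall>g\<in>carrier G. (x, \<phi> g x) \<in> E\<^sup>*"
  shows "cost G M \<phi> \<le> ereal (\<Sum>i\<in>I. measure M (A i))"
proof -
  interpret A: group_action G "space M" \<phi> using act by (simp add: pmp_action_def)
  interpret group G using A.group_hom group_hom.axioms(1) by blast
  interpret prob_space M using act by (simp add: pmp_action_def)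
  have sp [simp]: "space M = UNIV" using sets_eq_imp_space_eq[OF sets] by simp
  have \<phi>: "\<phi> g \<in> measurable M M" "distr M M (\<phi> g) = M" if "g \<in> carrier G" for g
    using act that by (auto simp: pmp_action_def)
  have inv: "\<phi> (inv\<^bsub>G\<^esub> g) (\<phi> g x) = x" if "g \<in> carrier G" for g x
    using A.orbit_sym_aux[of g x] that by simp
  have setsMM: "sets (M \<Otimes>\<^sub>M M) = sets borel"
    using sets_pair_measure_cong[OF sets sets] unfolding borel_prod .
  \<comment> \<open>The diagonal is closed in a Hausdorff space, which makes the graphs of the maps
    and the removal of loops measurable.\<close>
  have Id: "Id \<in> sets (M \<Otimes>\<^sub>M M)"
  proof -
    have "closed (Id :: ('x \<times> 'x) set)" using closed_diagonal by (simp add: Id_def)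
    then show ?thesis unfolding setsMM by (rule borel_closed)
  qed
  define K where "K i = {(x, y). x \<in> A i \<and> y = \<phi> (\<gamma> i) x}" for i
  define E where "E = (\<Union>i\<in>I. K i \<union> (K i)\<inverse>) - Id"
  have K: "K i \<in> sets (M \<Otimes>\<^sub>M M)" "(K i)\<inverse> \<in> sets (M \<Otimes>\<^sub>M M)" if i: "i \<in> I" for i
  proof -
    note [measurable] = \<phi>(1)[OF I(3)[OF i]] I(2)[OF i]
    have "(\<lambda>z. (\<phi> (\<gamma> i) (fst z), snd z)) -` Id \<inter> space (M \<Otimes>\<^sub>M M) \<in> sets (M \<Otimes>\<^sub>M M)"
      by (rule measurable_sets[OF _ Id]) measurable
    moreover have "A i \<times> UNIV \<in> sets (M \<Otimes>\<^sub>M M)" using I(2)[OF i] sets.top[of M] by simp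
    moreover have "K i = ((\<lambda>z. (\<phi> (\<gamma> i) (fst z), snd z)) -` Id \<inter> space (M \<Otimes>\<^sub>M M)) \<inter> (A i \<times> UNIV)"
      by (auto simp: K_def space_pair_measure)
    ultimately show Ki: "K i \<in> sets (M \<Otimes>\<^sub>M M)" by auto
    have "(\<lambda>z. (snd z, fst z)) -` K i \<inter> space (M \<Otimes>\<^sub>M M) \<in> sets (M \<Otimes>\<^sub>M M)"
      by (rule measurable_sets[OF _ Ki]) measurable
    moreover have "(K i)\<inverse> = (\<lambda>z. (snd z, fst z)) -` K i \<inter> space (M \<Otimes>\<^sub>M M)"
      by (auto simp: space_pair_measure)
    ultimately show "(K i)\<inverse> \<in> sets (M \<Otimes>\<^sub>M M)" by simp
  qed
  have "E \<in> sets (M \<Otimes>\<^sub>M M)"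
    unfolding E_def using K Id I(1) by (intro sets.Diff sets.finite_UN sets.Un) auto
  moreover have ER: "E \<subseteq> orbit_relation G M \<phi>"
  proof -
    have "x \<in> orbit G \<phi> (\<phi> g x)" if "g \<in> carrier G" for x g
      unfolding orbit_def using inv[OF that, of x] inv_closed[OF that] by (metis (mono_tags, lifting) mem_Collect_eq)
    then show ?thesis
      using I(3) by (fastforce simp: E_def K_def orbit_relation_def orbit_def)
  qed
  moreover have symE: "sym E" by (auto simp: E_def sym_def)
  moreover have "irrefl E" by (auto simp: E_def irrefl_def)
  moreover have "AE x in M. E\<^sup>* `` {x} = orbit_relation G M \<phi> `` {x}"
  proof -
    have "AE x in M. \<forall>g\<in>carrier G. (x, \<phi> g x) \<in> E\<^sup>*"
    proof (rule conn[OF symE])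
      fix x i assume "i \<in> I" "x \<in> A i"
      then show "(x, \<phi> (\<gamma> i) x) \<in> E\<^sup>*"
        by (cases "x = \<phi> (\<gamma> i) x") (auto simp: E_def K_def)
    qed
    then show ?thesis
    proof eventually_elim
      case (elim x)
      have "y \<in> orbit G \<phi> x" if "(x, y) \<in> E\<^sup>*" for y
        using that
      proof induction
        case base
        have "\<phi> \<one>\<^bsub>G\<^esub> x = x" using A.id_eq_one by (metis UNIV_I restrict_apply' sp)
        then show ?case unfolding orbit_def using one_closed by (metis (mono_tags, lifting) mem_Collect_eq)
      next
        case (step y z)
        then obtain g h where gh: "g \<in> carrier G" "y = \<phi> g x" "h \<in> carrier G" "z = \<phi> h y"
          using ER by (auto simp: orbit_relation_def orbit_def)
        then have "z = \<phi> (h \<otimes>\<^bsub>G\<^esub> g) x" using A.composition_rule[of x h g] by simp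
        then show ?case unfolding orbit_def using gh by blast
      qed
      then show ?case using elim by (auto simp: orbit_relation_def orbit_def)
    qed
  qed
  ultimately have E: "E \<in> graphings M (orbit_relation G M \<phi>)" by (simp add: graphings_def)
  \<comment> \<open>Only an inequality: several indices can give the same neighbour.\<close>
  have deg: "graph_degree E x \<le> (\<Sum>i\<in>I. indicator (A i) x + indicator (\<phi> (inv\<^bsub>G\<^esub> (\<gamma> i)) -` A i) x)" for x
  proof -
    let ?P = "{i \<in> I. x \<in> A i}" and ?Q = "{i \<in> I. \<phi> (inv\<^bsub>G\<^esub> (\<gamma> i)) x \<in> A i}"
    have sub: "E `` {x} \<subseteq> (\<lambda>i. \<phi> (\<gamma> i) x) ` ?P \<union> (\<lambda>i. \<phi> (inv\<^bsub>G\<^esub> (\<gamma> i)) x) ` ?Q" (is "_ \<subseteq> ?U")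
    proof
      fix y assume "y \<in> E `` {x}"
      then obtain i where i: "i \<in> I" and *: "x \<in> A i \<and> y = \<phi> (\<gamma> i) x \<or> y \<in> A i \<and> x = \<phi> (\<gamma> i) y"
        by (auto simp: E_def K_def)
      from * show "y \<in> ?U"
      proof
        assume "y \<in> A i \<and> x = \<phi> (\<gamma> i) y"
        then have "y = \<phi> (inv\<^bsub>G\<^esub> (\<gamma> i)) x" "y \<in> A i" using inv I(3)[OF i] by auto
        then show ?thesis using i by blast
      qed (use i in blast)
    qed
    have fin: "finite ?U" using I(1) by simp
    have "graph_degree E x = of_nat (card (E `` {x}))"
      unfolding graph_degree_def using finite_subset[OF sub fin] by (simp add: emeasure_count_space)
    also have "card (E `` {x}) \<le> card ?U" by (rule card_mono[OF fin sub])
    also have "card ?U \<le> card ?P + card ?Q"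
      using I(1) by (intro order_trans[OF card_Un_le] add_mono card_image_le) auto
    also have "of_nat (card ?P + card ?Q) =
        (\<Sum>i\<in>I. indicator (A i) x + indicator (\<phi> (inv\<^bsub>G\<^esub> (\<gamma> i)) -` A i) x :: ennreal)"
      using I(1) by (simp add: sum.distrib indicator_def sum.If_cases Int_def)
    finally show ?thesis by simp
  qed
  have "(\<integral>\<^sup>+x. graph_degree E x \<partial>M) \<le>
      (\<integral>\<^sup>+x. (\<Sum>i\<in>I. indicator (A i) x + indicator (\<phi> (inv\<^bsub>G\<^esub> (\<gamma> i)) -` A i) x) \<partial>M)"
    by (intro nn_integral_mono deg)
  also have "\<dots> = (\<Sum>i\<in>I. emeasure M (A i) + emeasure M (\<phi> (inv\<^bsub>G\<^esub> (\<gamma> i)) -` A i))"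
  proof -
    have "\<phi> (inv\<^bsub>G\<^esub> (\<gamma> i)) -` A i \<in> sets M" if "i \<in> I" for i
      using measurable_sets[OF \<phi>(1) I(2)[OF that], of "inv\<^bsub>G\<^esub> (\<gamma> i)"] I(3)[OF that] by simp
    then show ?thesis
      using I by (subst nn_integral_sum) (auto simp: nn_integral_add intro!: sum.cong)
  qed
  also have "\<dots> = (\<Sum>i\<in>I. 2 * emeasure M (A i))"
  proof (rule sum.cong[OF refl])
    fix i assume i: "i \<in> I"
    have c: "inv\<^bsub>G\<^esub> (\<gamma> i) \<in> carrier G" using I(3)[OF i] by simp
    have "emeasure M (\<phi> (inv\<^bsub>G\<^esub> (\<gamma> i)) -` A i) = emeasure (distr M M (\<phi> (inv\<^bsub>G\<^esub> (\<gamma> i)))) (A i)"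
      using emeasure_distr[OF \<phi>(1)[OF c] I(2)[OF i]] by simp
    then show "emeasure M (A i) + emeasure M (\<phi> (inv\<^bsub>G\<^esub> (\<gamma> i)) -` A i) = 2 * emeasure M (A i)"
      using \<phi>(2)[OF c] by (simp add: mult_2)
  qed
  also have "\<dots> = ennreal (2 * (\<Sum>i\<in>I. measure M (A i)))"
    by (simp add: emeasure_eq_measure sum_distrib_left[symmetric] ennreal_mult' sum_nonneg)
  finally have le: "(INF H\<in>graphings M (orbit_relation G M \<phi>). \<integral>\<^sup>+x. graph_degree H x \<partial>M)
      \<le> ennreal (2 * (\<Sum>i\<in>I. measure M (A i)))"
    by (rule INF_lower2[OF E])
  have "(INF H\<in>graphings M (orbit_relation G M \<phi>). \<integral>\<^sup>+x. graph_degree H x \<partial>M) / 2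
      \<le> ennreal (2 * (\<Sum>i\<in>I. measure M (A i))) / 2"
    by (rule divide_right_mono_ennreal[OF le])
  also have "\<dots> = ennreal (\<Sum>i\<in>I. measure M (A i))"
    by (subst divide_ennreal[of _ 2, simplified]) (auto simp: sum_nonneg)
  finally show ?thesis
    unfolding cost_def by (metis enn2ereal_ennreal less_eq_ennreal.rep_eq measure_nonneg sum_nonneg)
qed

section \<open>The lower bound\<close>

context countable_group
begin

definition coset_label :: "'a set \<Rightarrow> 'a set \<Rightarrow> real" where
  "coset_label H v = real (to_nat_on (rcosets H) v)"

text \<open>Cosets are coded as reals to fit the second factor of \<open>labelled_shift\<close>. The
  inverse turns right multiplication into a left action, and the identity off the finitely many
  codes extends it to all reals.\<close>

definition label_action :: "'a set \<Rightarrow> 'a \<Rightarrow> real \<Rightarrow> real" where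
  "label_action H g r =
     (if r \<in> coset_label H ` (rcosets H)
      then coset_label H (the_inv_into (rcosets H) (coset_label H) r #> inv g) else r)"

definition label_measure :: "'a set \<Rightarrow> real measure" where
  "label_measure H = distr (measure_pmf (pmf_of_set (rcosets H))) borel (coset_label H)"

context
  fixes H
  assumes H: "subgroup H G" "finite (rcosets H)"
begin

lemma inj_on_coset_label: "inj_on (coset_label H) (rcosets H)"
proof (rule inj_onI)
  fix v w assume vw: "v \<in> rcosets H" "w \<in> rcosets H" "coset_label H v = coset_label H w"
  then have "to_nat_on (rcosets H) v = to_nat_on (rcosets H) w" by (simp add: coset_label_def)
  then show "v = w" using vw countable_finite[OF H(2)] by simp
qed

lemma label_action_coset [simp]:
  "v \<in> rcosets H \<Longrightarrow> label_action H g (coset_label H v) = coset_label H (v #> inv g)"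
  by (simp add: label_action_def the_inv_into_f_f[OF inj_on_coset_label])

lemma label_action_other: "r \<notin> coset_label H ` (rcosets H) \<Longrightarrow> label_action H g r = r"
  by (simp add: label_action_def)

lemma group_action_label: "group_action G UNIV (label_action H)"
proof (rule group_actionI)
  fix g h :: 'a and r :: real
  assume g: "g \<in> carrier G" "h \<in> carrier G"
  show "label_action H (g \<otimes> h) r = label_action H g (label_action H h r)"
  proof (cases "r \<in> coset_label H ` (rcosets H)")
    case True
    then show ?thesis
      using g H by (auto simp: rcosets_closed rcoset_mult inv_mult_group)
  qed (simp add: label_action_other)
next
  fix r :: real
  show "label_action H \<one> r = r"
  proof (cases "r \<in> coset_label H ` (rcosets H)")
    case True
    then show ?thesis using H by (auto simp: rcoset_one)
  qed (simp add: label_action_other)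
qed (auto simp: is_group)

lemma prob_space_label_measure: "prob_space (label_measure H)"
  unfolding label_measure_def by (rule measure_pmf.prob_space_distr) simp

lemma sets_label_measure: "sets (label_measure H) = sets borel"
  by (simp add: label_measure_def)

lemma rcosets_nonempty: "rcosets H \<noteq> {}"
  using subgroup_in_own_rcosets[OF H(1)] by auto

lemma label_action_measurable: "label_action H g \<in> measurable borel borel"
proof (rule measurable_discrete_difference[where X = "coset_label H ` (rcosets H)"])
  show "(\<lambda>r. r) \<in> measurable borel (borel :: real measure)" by simp
qed (use H in \<open>auto simp: label_action_other intro: countable_finite\<close>)

lemma distr_label_action:
  assumes g: "g \<in> carrier G"
  shows "distr (label_measure H) (label_measure H) (label_action H g) = label_measure H"
proof -
  let ?V = "rcosets H"
  let ?p = "pmf_of_set ?V"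
  have bij: "bij_betw (\<lambda>v. v #> inv g) ?V ?V"
    using g H by (intro bij_betw_byWitness[where f' = "\<lambda>v. v #> g"])
      (auto simp: rcoset_mult_inv rcosets_closed)
  have "distr (label_measure H) (label_measure H) (label_action H g) =
      distr (label_measure H) borel (label_action H g)"
    by (rule distr_cong) (simp_all add: sets_label_measure)
  also have "\<dots> = distr ?p borel (label_action H g \<circ> coset_label H)"
    unfolding label_measure_def by (rule distr_distr) (simp_all add: label_action_measurable)
  also have "\<dots> = distr ?p borel (coset_label H \<circ> (\<lambda>v. v #> inv g))"
    using H rcosets_nonempty by (intro distr_cong_AE) (auto simp: AE_measure_pmf_iff)
  also have "\<dots> = distr (distr ?p (count_space UNIV) (\<lambda>v. v #> inv g)) borel (coset_label H)"
    by (rule distr_distr[symmetric]) simp_all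
  also have "distr ?p (count_space UNIV) (\<lambda>v. v #> inv g) = measure_pmf (map_pmf (\<lambda>v. v #> inv g) ?p)"
    by (rule map_pmf_rep_eq[symmetric])
  also have "map_pmf (\<lambda>v. v #> inv g) ?p = ?p"
    by (rule map_pmf_of_set_bij_betw[OF bij rcosets_nonempty H(2)])
  finally show ?thesis by (simp add: label_measure_def)
qed

lemma pmp_action_coset_shift:
  "pmp_action G (bernoulli \<Otimes>\<^sub>M label_measure H) (labelled_shift (label_action H))"
proof (rule pmp_action_labelled_shift)
  show "label_action H g \<in> measurable (label_measure H) (label_measure H)" for g
    using label_action_measurable measurable_cong_sets[OF sets_label_measure sets_label_measure] by blast
qed (simp_all add: prob_space_label_measure sets_label_measure group_action_label distr_label_action)

lemma essentially_free_coset_shift: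
  "essentially_free G (bernoulli \<Otimes>\<^sub>M label_measure H) (labelled_shift (label_action H))"
  by (rule essentially_free_labelled_shift) (simp_all add: prob_space_label_measure group_action_label)

definition fibre :: "'a set \<Rightarrow> ((nat \<Rightarrow> real) \<times> real) set" where
  "fibre v = UNIV \<times> {coset_label H v}"

lemma measure_fibre:
  assumes v: "v \<in> rcosets H"
  shows "fibre v \<in> sets (bernoulli \<Otimes>\<^sub>M label_measure H)"
    and "measure (bernoulli \<Otimes>\<^sub>M label_measure H) (fibre v) = 1 / card (rcosets H)"
proof -
  interpret L: prob_space "label_measure H" by (rule prob_space_label_measure)
  interpret I: prob_space bernoulli by (rule prob_space_iid)
  interpret P: pair_prob_space bernoulli "label_measure H" ..
  have s: "{coset_label H v} \<in> sets (label_measure H)" by (simp add: sets_label_measure)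
  have u: "UNIV \<in> sets bernoulli" using sets.top[of bernoulli] by simp
  show "fibre v \<in> sets (bernoulli \<Otimes>\<^sub>M label_measure H)"
    unfolding fibre_def using s u by (rule pair_measureI[rotated])
  have "measure (bernoulli \<Otimes>\<^sub>M label_measure H) (fibre v) =
      measure bernoulli UNIV * measure (label_measure H) {coset_label H v}"
    unfolding fibre_def measure_def L.emeasure_pair_measure_Times[OF u s] by (rule enn2real_mult)
  also have "measure bernoulli UNIV = 1" using I.prob_space by simp
  also have "measure (label_measure H) {coset_label H v} =
      measure (pmf_of_set (rcosets H)) (coset_label H -` {coset_label H v} \<inter> space (pmf_of_set (rcosets H)))"
    unfolding label_measure_def by (rule measure_distr) auto
  also have "\<dots> = measure (pmf_of_set (rcosets H)) {v}"
    using v inj_on_coset_label H rcosets_nonempty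
    by (intro measure_pmf.finite_measure_eq_AE) (auto simp: AE_measure_pmf_iff dest: inj_onD)
  also have "\<dots> = 1 / card (rcosets H)"
    using v H rcosets_nonempty by (simp add: measure_pmf_single)
  finally show "measure (bernoulli \<Otimes>\<^sub>M label_measure H) (fibre v) = 1 / card (rcosets H)" by simp
qed

text \<open>Over the root coset the generators of \<open>H\<close> connect orbits of \<open>H\<close>, and one further
  edge attaches every other fibre to the root fibre.\<close>

lemma cost_coset_shift_le:
  assumes B: "finite B" "B \<subseteq> H" "generate G B = H"
  shows "cost G (bernoulli \<Otimes>\<^sub>M label_measure H) (labelled_shift (label_action H)) \<le>
    ereal ((real (card B) + real (card (rcosets H)) - 1) / real (card (rcosets H)))"
proof -
  let ?M = "bernoulli \<Otimes>\<^sub>M label_measure H" and ?\<phi> = "labelled_shift (label_action H)"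
  let ?V = "rcosets H"
  interpret A: group_action G "space ?M" ?\<phi> using pmp_action_coset_shift by (simp add: pmp_action_def)
  have sets: "sets ?M = sets borel"
    using sets_pair_measure_cong[OF sets_iid sets_label_measure] unfolding borel_prod .
  have sp: "space ?M = UNIV" using sets_eq_imp_space_eq[OF sets] by simp
  have Hc: "H \<subseteq> carrier G" using H(1) by (rule subgroup.subset)
  have HV: "H \<in> ?V" by (rule subgroup_in_own_rcosets[OF H(1)])
  have mult: "?\<phi> (g \<otimes> h) z = ?\<phi> g (?\<phi> h z)" if "g \<in> carrier G" "h \<in> carrier G" for g h z
    using A.composition_rule[of z g h] that sp by simp
  have one: "?\<phi> \<one> z = z" for z
    using A.id_eq_one sp by (metis UNIV_I restrict_apply')
  have fib: "?\<phi> g z \<in> fibre (v #> inv g)" if "z \<in> fibre v" "v \<in> ?V" for g z v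
    using that by (auto simp: fibre_def labelled_shift_def)
  have "\<exists>t. t \<in> carrier G \<and> v = H #> t" if "v \<in> ?V" for v
    using rcosets_transitive[OF H(1) that] by blast
  then obtain t where t: "\<And>v. v \<in> ?V \<Longrightarrow> t v \<in> carrier G \<and> v = H #> t v" by metis
  have tinv: "v #> inv (t v) = H" if "v \<in> ?V" for v
    using rcoset_mult_inv(1)[OF H(1) HV, of "t v"] t[OF that] by simp
  \<comment> \<open>\<open>Inl\<close> indexes generators of \<open>H\<close>, acting over the root
    coset only; \<open>Inr\<close> indexes the connecting edges. This makes
    \<open>card B + card ?V - 1\<close> sets, each a fibre of measure
    \<open>1 / card ?V\<close>.\<close>
  define I where "I = Inl ` B \<union> Inr ` (?V - {H})"
  define A where "A = case_sum (\<lambda>_ :: 'a. fibre H) fibre"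
  define \<gamma> where "\<gamma> = case_sum (\<lambda>b. b) t"
  have I: "finite I" using B H by (auto simp: I_def)
  have "cost G ?M ?\<phi> \<le> ereal (\<Sum>i\<in>I. measure ?M (A i))"
  proof (rule cost_le_edges[OF pmp_action_coset_shift sets I])
    show "A i \<in> sets ?M" if "i \<in> I" for i
      using that measure_fibre(1) HV by (auto simp: I_def A_def)
    show "\<gamma> i \<in> carrier G" if "i \<in> I" for i
      using that B Hc t by (auto simp: I_def \<gamma>_def)
    fix E :: "((nat \<Rightarrow> real) \<times> real) rel"
    assume sym: "sym E" and edge: "\<And>x i. i \<in> I \<Longrightarrow> x \<in> A i \<Longrightarrow> (x, ?\<phi> (\<gamma> i) x) \<in> E\<^sup>*"
    have symE: "(x, y) \<in> E\<^sup>* \<Longrightarrow> (y, x) \<in> E\<^sup>*" for x y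
      using sym_rtrancl[OF sym] by (auto dest: symD)
    \<comment> \<open>Elements of \<open>H\<close> preserve the root fibre, so after each letter the
      edges of the next generator are still available.\<close>
    have root: "\<forall>z\<in>fibre H. (z, ?\<phi> h z) \<in> E\<^sup>*" if "h \<in> generate G B" for h
      using that
    proof induction
      case one
      then show ?case by (simp add: \<open>\<And>z. ?\<phi> \<one> z = z\<close>)
    next
      case (incl h)
      then show ?case using edge[of "Inl h"] by (auto simp: I_def A_def \<gamma>_def)
    next
      case (inv h)
      show ?case
      proof
        fix z assume z: "z \<in> fibre H"
        have h: "h \<in> carrier G" "h \<in> H" using inv B Hc by auto
        have "?\<phi> (inv h) z \<in> fibre H"
          using fib[OF z HV, of "inv h"] coset_join2[OF h(1) H(1) h(2)] h by simp
        then have "(?\<phi> (inv h) z, ?\<phi> h (?\<phi> (inv h) z)) \<in> E\<^sup>*"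
          using edge[of "Inl h" "?\<phi> (inv h) z"] inv by (simp add: I_def A_def \<gamma>_def)
        moreover have "?\<phi> h (?\<phi> (inv h) z) = z" using mult[of h "inv h" z] h one by simp
        ultimately show "(z, ?\<phi> (inv h) z) \<in> E\<^sup>*" using symE by simp
      qed
    next
      case (eng h1 h2)
      show ?case
      proof
        fix z assume z: "z \<in> fibre H"
        have h: "h1 \<in> carrier G" "h2 \<in> carrier G" "inv h2 \<in> H"
          using eng B Hc subgroup.m_inv_closed[OF H(1)] by auto
        have "?\<phi> h2 z \<in> fibre H"
          using fib[OF z HV, of h2] coset_join2[OF _ H(1) h(3)] h by simp
        then have "(?\<phi> h2 z, ?\<phi> h1 (?\<phi> h2 z)) \<in> E\<^sup>*" using eng by simp
        then show "(z, ?\<phi> (h1 \<otimes> h2) z) \<in> E\<^sup>*"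
          using mult[OF h(1,2)] eng z by (auto intro: rtrancl_trans)
      qed
    qed
    have to_root: "\<exists>s\<in>carrier G. v #> inv s = H \<and> (z, ?\<phi> s z) \<in> E\<^sup>*" if v: "v \<in> ?V" and z: "z \<in> fibre v" for v z
    proof (cases "v = H")
      case True
      then show ?thesis using one rcoset_one[OF H(1) HV] by (intro bexI[of _ \<one>]) auto
    next
      case False
      then show ?thesis
        using edge[of "Inr v" z] v z t tinv[OF v] by (intro bexI[of _ "t v"]) (auto simp: I_def A_def \<gamma>_def)
    qed
    have all: "(z, ?\<phi> g z) \<in> E\<^sup>*" if v: "v \<in> ?V" and z: "z \<in> fibre v" and g: "g \<in> carrier G" for v z g
    proof -
      have v': "v #> inv g \<in> ?V" using rcosets_closed[OF H(1) v] g by simp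
      have z': "?\<phi> g z \<in> fibre (v #> inv g)" by (rule fib[OF z v])
      obtain s where s: "s \<in> carrier G" "v #> inv s = H" "(z, ?\<phi> s z) \<in> E\<^sup>*" using to_root[OF v z] by auto
      obtain u where u: "u \<in> carrier G" "v #> inv g #> inv u = H" "(?\<phi> g z, ?\<phi> u (?\<phi> g z)) \<in> E\<^sup>*"
        using to_root[OF v' z'] by auto
      \<comment> \<open>Both \<open>z\<close> and its translate by \<open>g\<close> are carried to
        the root fibre, by \<open>s\<close> and \<open>u\<close>. The element between the two
        landing points fixes the root coset, hence lies in \<open>H\<close>.\<close>
      let ?h = "u \<otimes> g \<otimes> inv s"
      have h: "?h \<in> carrier G" using u s g by simp
      have "H #> inv ?h = v #> inv s #> (s \<otimes> inv g \<otimes> inv u)"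
        using u s g by (simp add: inv_mult_group m_assoc)
      also have "\<dots> = v #> (inv s \<otimes> (s \<otimes> inv g \<otimes> inv u))"
        using u s g by (intro rcoset_mult[OF H(1) v]) auto
      also have "inv s \<otimes> (s \<otimes> inv g \<otimes> inv u) = inv g \<otimes> inv u"
        using u s g by (simp add: m_assoc[symmetric])
      also have "v #> (inv g \<otimes> inv u) = H"
        using u g rcoset_mult[OF H(1) v, of "inv g" "inv u"] by simp
      finally have "inv ?h \<in> H" using coset_join1[of H "inv ?h"] h H(1) Hc by simp
      then have "?h \<in> H" using subgroup.m_inv_closed[OF H(1), of "inv ?h"] h by simp
      then have hB: "?h \<in> generate G B" using B by simp
      have root_s: "?\<phi> s z \<in> fibre H" using fib[OF z v, of s] s by simp
      have "?\<phi> ?h (?\<phi> s z) = ?\<phi> (?h \<otimes> s) z" using mult[OF h s(1)] by simp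
      also have "?h \<otimes> s = u \<otimes> g" using u s g by (simp add: m_assoc)
      also have "?\<phi> (u \<otimes> g) z = ?\<phi> u (?\<phi> g z)" by (rule mult[OF u(1) g])
      finally have "(?\<phi> s z, ?\<phi> u (?\<phi> g z)) \<in> E\<^sup>*" using root[OF hB] root_s by auto
      then show ?thesis using s(3) symE[OF u(3)] by (meson rtrancl_trans)
    qed
    have "AE z in ?M. snd z \<in> coset_label H ` ?V"
    proof -
      interpret L: prob_space "label_measure H" by (rule prob_space_label_measure)
      interpret I: prob_space bernoulli by (rule prob_space_iid)
      interpret P: pair_prob_space bernoulli "label_measure H" ..
      have bs: "coset_label H ` ?V \<in> sets borel"
        using H(2) by (intro borel_closed finite_imp_closed) simp
      have "AE r in label_measure H. r \<in> coset_label H ` ?V"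
        unfolding label_measure_def using H rcosets_nonempty bs
        by (subst AE_distr_iff) (auto simp: AE_measure_pmf_iff)
      moreover have "{z \<in> space ?M. snd z \<in> coset_label H ` ?V} = UNIV \<times> coset_label H ` ?V"
        using sp by auto
      moreover have "UNIV \<times> coset_label H ` ?V \<in> sets ?M"
        using bs sets.top[of bernoulli] by (intro pair_measureI) (simp_all add: sets_label_measure)
      ultimately show ?thesis by (intro P.AE_pair_measure) auto
    qed
    then show "AE z in ?M. \<forall>g\<in>carrier G. (z, ?\<phi> g z) \<in> E\<^sup>*"
    proof eventually_elim
      case (elim z)
      then obtain v where "v \<in> ?V" "z \<in> fibre v" by (cases z) (auto simp: fibre_def)
      then show ?case using all by blast
    qed
  qed
  also have "(\<Sum>i\<in>I. measure ?M (A i)) = (\<Sum>i\<in>I. 1 / real (card ?V))"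
    using measure_fibre(2) HV by (intro sum.cong) (auto simp: I_def A_def)
  also have "\<dots> = real (card I) / real (card ?V)" by simp
  also have "card I = card B + card (?V - {H})"
    unfolding I_def using B H by (subst card_Un_disjoint) (auto simp: card_image)
  also have "card (?V - {H}) = card ?V - 1" using HV by simp
  also have "real (card B + (card ?V - 1)) = real (card B) + real (card ?V) - 1"
    using H(2) rcosets_nonempty by (simp add: of_nat_diff Suc_leI card_gt_0_iff)
  finally show ?thesis .
qed

end

lemma rank_ratio_lower:
  assumes price: "fixed_price G c" and H: "subgroup H G" "finite (rcosets H)"
    and S: "finite S" "S \<subseteq> carrier G" "generate G S = carrier G"
  shows "c - 1 \<le> rank_ratio G H"
proof -
  obtain B where B: "finite B" "B \<subseteq> H" "generate G B = H" "card B = group_rank (G\<lparr>carrier := H\<rparr>)"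
    using finite_index_generators[OF H S] by blast
  obtain J :: "(nat \<Rightarrow> real) \<times> real \<Rightarrow> real" where "inj J" using inj_seq_to_real by blast
  from fixed_price_cost[OF price this pmp_action_coset_shift[OF H] essentially_free_coset_shift[OF H]]
    cost_coset_shift_le[OF H B(1-3)]
  have "c \<le> (real (card B) + real (card (rcosets H)) - 1) / real (card (rcosets H))" by simp
  moreover have "card (rcosets H) > 0" using H(2) rcosets_nonempty[OF H] by (simp add: card_gt_0_iff)
  ultimately show ?thesis
    unfolding rank_ratio_def subgroup_index_def B(4) by (simp add: field_simps)
qed

section \<open>Finite cylinder graphs\<close>

text \<open>A right action, so that the labels along a walk multiply in the order in which they are read.\<close>

definition move :: "(nat \<Rightarrow> real) \<Rightarrow> 'a \<Rightarrow> (nat \<Rightarrow> real)" where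
  "move x g = shift (inv g) x"

lemma move_mult: "g \<in> carrier G \<Longrightarrow> h \<in> carrier G \<Longrightarrow> move (move x g) h = move x (g \<otimes> h)"
  by (simp add: move_def inv_mult_group shift_mult)

lemma move_one: "move x \<one> = x"
  by (simp add: move_def shift_one)

lemma move_inv:
  assumes "g \<in> carrier G"
  shows "move (move x g) (inv g) = x" "move (move x (inv g)) g = x"
  using assms by (simp_all add: move_mult move_one)

lemma move_site: "g \<in> carrier G \<Longrightarrow> h \<in> carrier G \<Longrightarrow> move x g (site h) = x (site (g \<otimes> h))"
  by (simp add: move_def shift_def)

lemma move_measurable [measurable]: "(\<lambda>x. move x g) \<in> measurable bernoulli bernoulli"
  unfolding move_def by measurable

lemma distr_move: "g \<in> carrier G \<Longrightarrow> distr bernoulli bernoulli (\<lambda>x. move x g) = bernoulli"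
  unfolding move_def by (rule distr_shift) simp

lemma move_vimage_sets: "B \<in> sets bernoulli \<Longrightarrow> (\<lambda>x. move x g) -` B \<in> sets bernoulli"
  using measurable_sets[OF move_measurable, of B g] by simp

lemma move_vimage_cylinders: "B \<in> cylinders \<Longrightarrow> (\<lambda>x. move x g) -` B \<in> cylinders"
  unfolding move_def shift_def by (rule cylinders_vimage)

lemma emeasure_move_vimage:
  "g \<in> carrier G \<Longrightarrow> B \<in> sets bernoulli \<Longrightarrow>
     emeasure bernoulli ((\<lambda>x. move x g) -` B) = emeasure bernoulli B"
  using emeasure_distr[OF move_measurable, of B g] distr_move by simp

lemma measure_move_vimage:
  "g \<in> carrier G \<Longrightarrow> B \<in> sets bernoulli \<Longrightarrow>
     measure bernoulli ((\<lambda>x. move x g) -` B) = measure bernoulli B"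
  by (simp add: measure_def emeasure_move_vimage)

lemma inj_move: "g \<in> carrier G \<Longrightarrow> inj x \<Longrightarrow> inj (move x g)"
  unfolding move_def shift_def using bij_shift_index by (intro inj_compose) (auto simp: bij_is_inj)

lemma move_cancel:
  assumes "inj x" "g \<in> carrier G" "h \<in> carrier G" "move x g = move x h"
  shows "g = h"
proof -
  have "x (site (g \<otimes> \<one>)) = x (site (h \<otimes> \<one>))"
    using assms(2-4) move_site[of _ \<one> x] by (metis one_closed)
  then have "site g = site h" using assms by (auto dest: injD)
  then show ?thesis using inj_on_site assms(2,3) by (auto dest: inj_onD)
qed

section \<open>Cheap graphings of the shift and their orientation\<close>

lemma cost_bernoulli:
  assumes "fixed_price G c"
  shows "cost G bernoulli shift = ereal c"
proof -
  obtain J :: "(nat \<Rightarrow> real) \<times> real \<Rightarrow> real" where J: "inj J" using inj_seq_to_real by blast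
  have "inj (\<lambda>x. J (x, 0))" by (rule injI) (simp add: inj_eq[OF J])
  then show ?thesis
    using fixed_price_cost[OF assms _ pmp_action_shift essentially_free_shift] by blast
qed

text \<open>The sign of \<open>c\<close> is settled first, since \<open>ennreal\<close> sends
  negative numbers to 0. As \<open>c\<close> is finite, \<open>2 * (c + \<epsilon>)\<close> lies
  strictly above the infimum of the integrated degrees.\<close>

lemma cheap_graphing:
  assumes price: "fixed_price G c" and \<epsilon>: "\<epsilon> > 0"
  shows "0 \<le> c"
    and "\<exists>E\<in>graphings bernoulli (orbit_relation G bernoulli shift).
       (\<integral>\<^sup>+x. graph_degree E x \<partial>bernoulli) < ennreal (2 * (c + \<epsilon>))"
proof -
  let ?I = "INF E\<in>graphings bernoulli (orbit_relation G bernoulli shift). \<integral>\<^sup>+x. graph_degree E x \<partial>bernoulli"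
  have eq: "enn2ereal (?I / 2) = ereal c"
    using cost_bernoulli[OF price] by (simp add: cost_def)
  show c: "0 \<le> c"
    using enn2ereal_nonneg[of "?I / 2"] unfolding eq by simp
  have I: "?I / 2 = ennreal c"
    using eq c by (metis e2ennreal_enn2ereal e2ennreal_ereal)
  have "?I < ennreal (2 * (c + \<epsilon>))"
  proof (rule ccontr)
    assume "\<not> ?thesis"
    then have "ennreal (2 * (c + \<epsilon>)) / 2 \<le> ?I / 2" by (intro divide_right_mono_ennreal) simp
    moreover have half: "ennreal (2 * t) / 2 = ennreal t" if "t \<ge> 0" for t
      using that by (subst divide_ennreal[of _ 2, simplified]) auto
    have "ennreal (2 * (c + \<epsilon>)) / 2 = ennreal (c + \<epsilon>)"
      by (rule half) (use c \<epsilon> in simp)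
    ultimately show False using c \<epsilon> unfolding I by (simp add: ennreal_le_iff)
  qed
  then show "\<exists>E\<in>graphings bernoulli (orbit_relation G bernoulli shift).
       (\<integral>\<^sup>+x. graph_degree E x \<partial>bernoulli) < ennreal (2 * (c + \<epsilon>))"
    by (simp add: INF_less_iff)
qed

definition labelled_edges :: "('a \<Rightarrow> (nat \<Rightarrow> real) set) \<Rightarrow> ((nat \<Rightarrow> real) \<times> 'a) set" where
  "labelled_edges D = {(x, g). x \<in> D g}"

text \<open>Orienting every edge of the graphing towards the larger coordinate at the identity counts it
  once, so that no factor 2 is left.\<close>

definition oriented :: "((nat \<Rightarrow> real) \<times> (nat \<Rightarrow> real)) set \<Rightarrow> 'a \<Rightarrow> (nat \<Rightarrow> real) set" where
  "oriented E g = {x. (x, move x g) \<in> E \<and> x (site \<one>) < x (site g)}"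

lemma oriented_sets:
  assumes "E \<in> sets (bernoulli \<Otimes>\<^sub>M bernoulli)"
  shows "oriented E g \<in> sets bernoulli"
proof -
  have "(\<lambda>x. (x, move x g)) -` E \<inter> space bernoulli \<in> sets bernoulli"
    by (rule measurable_sets[OF _ assms]) measurable
  moreover have "(\<lambda>x. x k) \<in> borel_measurable bernoulli" for k
    using measurable_component_singleton[of k UNIV "\<lambda>_. uniform01"] by simp
  then have "{x \<in> space bernoulli. x (site \<one>) < x (site g)} \<in> sets bernoulli"
    by (intro borel_measurable_less)
  ultimately have "((\<lambda>x. (x, move x g)) -` E \<inter> space bernoulli) \<inter>
      {x \<in> space bernoulli. x (site \<one>) < x (site g)} \<in> sets bernoulli"
    by (rule sets.Int)
  also have "((\<lambda>x. (x, move x g)) -` E \<inter> space bernoulli) \<inter>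
      {x \<in> space bernoulli. x (site \<one>) < x (site g)} = oriented E g"
    by (auto simp: oriented_def)
  finally show ?thesis .
qed

text \<open>Outgoing edges lead to points with a larger label at the identity and incoming ones
  start at points with a smaller label, so the two families of neighbours are disjoint. Within a
  family, injectivity of \<open>x\<close> gives distinct neighbours for distinct labels.\<close>

lemma oriented_degree:
  assumes sym: "sym E" and x: "inj x" and F: "finite F" "F \<subseteq> carrier G"
  shows "(\<Sum>g\<in>F. indicator (oriented E g) x + indicator ((\<lambda>x. move x (inv g)) -` oriented E g) x)
    \<le> graph_degree E x"
proof -
  let ?P = "{g \<in> F. x \<in> oriented E g}" and ?Q = "{g \<in> F. move x (inv g) \<in> oriented E g}"
  let ?p = "(\<lambda>g. move x g) ` ?P" and ?q = "(\<lambda>g. move x (inv g)) ` ?Q"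
  have p: "x (site \<one>) < y (site \<one>)" if "y \<in> ?p" for y
    using that F by (auto simp: oriented_def move_site subsetD)
  have q: "y (site \<one>) < x (site \<one>)" if y: "y \<in> ?q" for y
  proof -
    obtain g where g: "g \<in> carrier G" "y = move x (inv g)" "move x (inv g) \<in> oriented E g"
      using y F by auto
    have "y (site g) = x (site \<one>)" using g by (simp add: move_site)
    then show ?thesis using g by (simp add: oriented_def)
  qed
  have inj_p: "inj_on (\<lambda>g. move x g) ?P"
    using move_cancel[OF x] F by (auto intro!: inj_onI)
  have inj_q: "inj_on (\<lambda>g. move x (inv g)) ?Q"
  proof (rule inj_onI)
    fix g h assume gh: "g \<in> ?Q" "h \<in> ?Q" "move x (inv g) = move x (inv h)"
    then have c: "g \<in> carrier G" "h \<in> carrier G" using F by auto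
    have "inv g = inv h" by (rule move_cancel[OF x _ _ gh(3)]) (use c in auto)
    then show "g = h" using c by (metis inv_inv)
  qed
  have sub: "?p \<union> ?q \<subseteq> E `` {x}"
  proof
    fix y assume "y \<in> ?p \<union> ?q"
    then show "y \<in> E `` {x}"
    proof
      assume "y \<in> ?q"
      then obtain g where g: "g \<in> carrier G" "y = move x (inv g)" "y \<in> oriented E g" using F by auto
      then have "(y, x) \<in> E" by (auto simp: oriented_def move_inv)
      then show ?thesis using sym by (auto dest: symD)
    qed (auto simp: oriented_def)
  qed
  have "(\<Sum>g\<in>F. indicator (oriented E g) x + indicator ((\<lambda>x. move x (inv g)) -` oriented E g) x :: ennreal)
      = of_nat (card ?P + card ?Q)"
    using F(1) by (simp add: sum.distrib indicator_def sum.If_cases Int_def)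
  also have "card ?P + card ?Q = card ?p + card ?q"
    using card_image[OF inj_p] card_image[OF inj_q] by simp
  also have "\<dots> = card (?p \<union> ?q)"
    using F(1) p q by (intro card_Un_disjoint[symmetric]) fastforce+
  also have "of_nat (card (?p \<union> ?q)) = emeasure (count_space UNIV) (?p \<union> ?q)"
    using F(1) by (subst emeasure_count_space_finite) auto
  also have "\<dots> \<le> graph_degree E x"
    unfolding graph_degree_def by (rule emeasure_mono[OF sub]) simp
  finally show ?thesis .
qed

text \<open>Integrating the degree bound gives twice the sum by invariance. The bound
  \<open>C\<close> is uniform in \<open>F\<close>, so that \<open>F\<close> can be chosen later to
  fit the words in use.\<close>

lemma oriented_measure_sum:
  assumes E: "E \<in> graphings bernoulli (orbit_relation G bernoulli shift)"
    and deg: "(\<integral>\<^sup>+x. graph_degree E x \<partial>bernoulli) < ennreal (2 * C)"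
    and F: "finite F" "F \<subseteq> carrier G"
  shows "(\<Sum>g\<in>F. measure bernoulli (oriented E g)) \<le> C"
proof -
  interpret prob_space bernoulli by (rule prob_space_iid)
  have Es: "E \<in> sets (bernoulli \<Otimes>\<^sub>M bernoulli)" "sym E" using E by (auto simp: graphings_def)
  note A = oriented_sets[OF Es(1)]
  have "ennreal (2 * (\<Sum>g\<in>F. prob (oriented E g))) = (\<Sum>g\<in>F. 2 * emeasure bernoulli (oriented E g))"
    by (simp add: emeasure_eq_measure sum_distrib_left[symmetric] ennreal_mult' sum_nonneg)
  also have "\<dots> = (\<Sum>g\<in>F. emeasure bernoulli (oriented E g) +
      emeasure bernoulli ((\<lambda>x. move x (inv g)) -` oriented E g))"
    using F A by (intro sum.cong) (auto simp: emeasure_move_vimage mult_2 subsetD)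
  also have "\<dots> = (\<integral>\<^sup>+x. (\<Sum>g\<in>F. indicator (oriented E g) x +
      indicator ((\<lambda>x. move x (inv g)) -` oriented E g) x) \<partial>bernoulli)"
    using A move_vimage_sets[OF A]
    by (subst nn_integral_sum) (auto simp: nn_integral_add intro!: sum.cong)
  also have "\<dots> \<le> (\<integral>\<^sup>+x. graph_degree E x \<partial>bernoulli)"
  proof (rule nn_integral_mono_AE)
    show "AE x in bernoulli. (\<Sum>g\<in>F. indicator (oriented E g) x +
      indicator ((\<lambda>x. move x (inv g)) -` oriented E g) x) \<le> graph_degree E x"
      using AE_iid_inj by eventually_elim (rule oriented_degree[OF Es(2) _ F])
  qed
  finally have "ennreal (2 * (\<Sum>g\<in>F. prob (oriented E g))) < ennreal (2 * C)"
    using deg by (rule le_less_trans)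
  then show ?thesis by (simp add: ennreal_less_iff sum_nonneg)
qed

text \<open>A path of \<open>E\<close> from \<open>x\<close> to \<open>move x s\<close> spells a
  word whose product moves \<open>x\<close> to the same point. At an injective \<open>x\<close> the
  product must then be \<open>s\<close>.\<close>

lemma oriented_walk_connected:
  assumes E: "E \<in> graphings bernoulli (orbit_relation G bernoulli shift)" and S: "S \<subseteq> carrier G"
  shows "AE x in bernoulli. walk_connected G move (labelled_edges (oriented E)) S x"
proof -
  have Es: "E \<subseteq> orbit_relation G bernoulli shift" "sym E" "irrefl E"
    and conn: "AE x in bernoulli. E\<^sup>* `` {x} = orbit_relation G bernoulli shift `` {x}"
    using E by (auto simp: graphings_def)
  let ?L = "labelled_edges (oriented E)"
  have step: "\<exists>g\<in>carrier G. y = move x g \<and> ((x, g) \<in> ?L \<or> (y, inv g) \<in> ?L)"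
    if xy: "(x, y) \<in> E" and x: "inj x" for x y
  proof -
    obtain k where k: "k \<in> carrier G" "y = shift k x"
      using Es(1) xy by (auto simp: orbit_relation_def orbit_def)
    define g where "g = inv k"
    have g: "g \<in> carrier G" "y = move x g" using k by (auto simp: g_def move_def)
    have "g \<noteq> \<one>" using Es(3) xy g by (auto simp: move_one irrefl_def)
    then have "site g \<noteq> site \<one>" using inj_on_site g by (auto dest: inj_onD)
    then have "x (site g) \<noteq> x (site \<one>)" using x by (auto dest: injD)
    moreover have "y (site \<one>) = x (site g)" "y (site (inv g)) = x (site \<one>)"
      using g by (simp_all add: move_site)
    moreover have "(y, move y (inv g)) \<in> E"
      using xy Es(2) g by (auto simp: move_inv dest: symD)
    ultimately show ?thesis
      using xy g by (intro bexI[of _ g]) (auto simp: labelled_edges_def oriented_def)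
  qed
  \<comment> \<open>Injectivity is carried along the path, because orienting each edge requires the
    two compared labels to differ.\<close>
  have path: "inj x \<longrightarrow> (\<exists>w\<in>lists (carrier G). walk G move ?L w x \<and> z = move x (word_val G w))"
    if "(x, z) \<in> E\<^sup>*" for x z
    using that
  proof (induction rule: converse_rtrancl_induct)
    case base
    then show ?case by (auto intro!: bexI[of _ "[]"] simp: move_one)
  next
    case (step x y)
    show ?case
    proof
      assume x: "inj x"
      obtain g where g: "g \<in> carrier G" "y = move x g" "(x, g) \<in> ?L \<or> (y, inv g) \<in> ?L"
        using \<open>\<And>x y. (x, y) \<in> E \<Longrightarrow> inj x \<Longrightarrow> \<exists>g\<in>carrier G. y = move x g \<and> ((x, g) \<in> ?L \<or> (y, inv g) \<in> ?L)\<close>[OF step.hyps(1) x]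
        by auto
      obtain w where w: "w \<in> lists (carrier G)" "walk G move ?L w y" "z = move y (word_val G w)"
        using step.IH inj_move[OF g(1) x] g(2) by auto
      show "\<exists>w\<in>lists (carrier G). walk G move ?L w x \<and> z = move x (word_val G w)"
        using g w word_val_closed[OF w(1)] by (intro bexI[of _ "g # w"]) (auto simp: move_mult)
    qed
  qed
  show ?thesis
    using AE_iid_inj conn
  proof eventually_elim
    case (elim x)
    show ?case unfolding walk_connected_def
    proof
      fix s assume "s \<in> S"
      then have s: "s \<in> carrier G" using S by auto
      then have "(x, move x s) \<in> orbit_relation G bernoulli shift"
        by (auto simp: orbit_relation_def orbit_def move_def)
      then have "(x, move x s) \<in> E\<^sup>*" using elim(2) by auto
      then obtain w where w: "w \<in> lists (carrier G)" "walk G move ?L w x" "move x s = move x (word_val G w)"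
        using path elim(1) by blast
      then show "\<exists>w\<in>lists (carrier G). word_val G w = s \<and> walk G move ?L w x"
        using move_cancel[OF elim(1) s word_val_closed[OF w(1)] w(3)] by auto
    qed
  qed
qed

section \<open>Walks under small changes of the edge sets\<close>

lemma walk_set_Cons:
  "{x. walk G move (labelled_edges D) (g # w) x} =
     (D g \<union> (\<lambda>x. move x g) -` D (inv g)) \<inter> (\<lambda>x. move x g) -` {x. walk G move (labelled_edges D) w x}"
  by (auto simp: labelled_edges_def)

lemma walk_set_measurable:
  assumes "\<And>g. D g \<in> sets bernoulli"
  shows "{x. walk G move (labelled_edges D) w x} \<in> sets bernoulli"
proof (induction w)
  case Nil
  then show ?case using sets.top[of bernoulli] by simp
next
  case (Cons g w)
  then show ?case unfolding walk_set_Cons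
    by (intro sets.Int sets.Un move_vimage_sets assms)
qed

lemma walk_set_cylinders:
  assumes "\<And>g. D g \<in> cylinders"
  shows "{x. walk G move (labelled_edges D) w x} \<in> cylinders"
proof (induction w)
  case Nil
  then show ?case using cylinders_Compl[OF cylinders_empty] by simp
next
  case (Cons g w)
  then show ?case unfolding walk_set_Cons
    by (intro cylinders_Int cylinders_Un move_vimage_cylinders assms)
qed

lemma walk_mono:
  "(\<And>g. D g \<subseteq> D' g) \<Longrightarrow> walk G move (labelled_edges D) w x \<Longrightarrow> walk G move (labelled_edges D') w x"
  by (induction w arbitrary: x) (auto simp: labelled_edges_def)

text \<open>A walk is lost only if one of its steps is lost. Each step uses a forward or a backward
  edge, and by invariance each of the two loses at most \<open>\<eta>\<close>, whence the factor 2
  per letter.\<close>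

lemma walk_difference:
  assumes A: "\<And>g. A g \<in> sets bernoulli" and B: "\<And>g. B g \<in> sets bernoulli"
    and w: "w \<in> lists (carrier G)"
    and \<eta>: "\<And>g. g \<in> set w \<Longrightarrow> measure bernoulli (A g - B g) \<le> \<eta> \<and>
      measure bernoulli (A (inv g) - B (inv g)) \<le> \<eta>"
  shows "measure bernoulli ({x. walk G move (labelled_edges A) w x} - {x. walk G move (labelled_edges B) w x})
    \<le> 2 * \<eta> * length w"
  using w \<eta>
proof (induction w)
  case Nil
  then show ?case by simp
next
  case (Cons g w)
  interpret prob_space bernoulli by (rule prob_space_iid)
  let ?W = "\<lambda>D w. {x. walk G move (labelled_edges D) w x}"
  let ?m = "\<lambda>x. move x g"
  have g: "g \<in> carrier G" using Cons by auto
  have s: "A g - B g \<in> events" "A (inv g) - B (inv g) \<in> events" "?W A w - ?W B w \<in> events"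
    using A B walk_set_measurable[OF A] walk_set_measurable[OF B] by auto
  have "prob (?W A (g # w) - ?W B (g # w)) \<le>
      prob ((A g - B g) \<union> ?m -` (A (inv g) - B (inv g)) \<union> ?m -` (?W A w - ?W B w))"
    unfolding walk_set_Cons using s move_vimage_sets[OF s(2), of g] move_vimage_sets[OF s(3), of g]
    by (intro finite_measure_mono) auto
  also have "\<dots> \<le> prob ((A g - B g) \<union> ?m -` (A (inv g) - B (inv g))) + prob (?m -` (?W A w - ?W B w))"
    using s move_vimage_sets[OF s(2), of g] move_vimage_sets[OF s(3), of g] by (intro measure_Un_le) auto
  also have "prob ((A g - B g) \<union> ?m -` (A (inv g) - B (inv g))) \<le>
      prob (A g - B g) + prob (?m -` (A (inv g) - B (inv g)))"
    using s move_vimage_sets[OF s(2), of g] by (intro measure_Un_le) auto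
  finally have "prob (?W A (g # w) - ?W B (g # w)) \<le>
      prob (A g - B g) + prob (A (inv g) - B (inv g)) + prob (?W A w - ?W B w)"
    using measure_move_vimage[OF g s(2)] measure_move_vimage[OF g s(3)] by simp
  also have "\<dots> \<le> \<eta> + \<eta> + 2 * \<eta> * length w"
    using Cons by (intro add_mono) auto
  finally show ?case by (simp add: algebra_simps)
qed

text \<open>The points served by the first \<open>k\<close> words increase to a set of full measure,
  so some finite \<open>k\<close> suffices up to \<open>\<delta>\<close>.\<close>

lemma finitely_many_words:
  assumes A: "\<And>g. A g \<in> sets bernoulli" and S: "finite S"
    and conn: "AE x in bernoulli. walk_connected G move (labelled_edges A) S x" and \<delta>: "\<delta> > 0"
  obtains W where "finite W" "W \<subseteq> lists (carrier G)"
    "{x. \<forall>s\<in>S. \<exists>w\<in>W. word_val G w = s \<and> walk G move (labelled_edges A) w x} \<in> sets bernoulli"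
    "measure bernoulli {x. \<forall>s\<in>S. \<exists>w\<in>W. word_val G w = s \<and> walk G move (labelled_edges A) w x} > 1 - \<delta>"
proof -
  interpret prob_space bernoulli by (rule prob_space_iid)
  have cl: "countable (lists (carrier G))" using countable_carrier by (rule countable_lists)
  define code where "code = to_nat_on (lists (carrier G))"
  have inj: "inj_on code (lists (carrier G))" unfolding code_def by (rule inj_on_to_nat_on[OF cl])
  define W where "W k = {w \<in> lists (carrier G). code w < k}" for k
  have finW: "finite (W k)" for k
  proof (rule inj_on_finite)
    show "inj_on code (W k)" using inj by (rule inj_on_subset) (auto simp: W_def)
    show "code ` W k \<subseteq> {..<k}" by (auto simp: W_def)
  qed simp
  define T where "T k = {x. \<forall>s\<in>S. \<exists>w\<in>W k. word_val G w = s \<and> walk G move (labelled_edges A) w x}" for k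
  have Teq: "T k = space bernoulli \<inter> (\<Inter>s\<in>S. \<Union>w\<in>{w \<in> W k. word_val G w = s}. {x. walk G move (labelled_edges A) w x})" for k
    by (auto simp: T_def)
  have T: "T k \<in> events" for k
    unfolding Teq using S finW walk_set_measurable[OF A] sets.top[of bernoulli]
    by (cases "S = {}") (auto intro!: sets.Int sets.finite_INT sets.finite_UN)
  have "incseq T"
    by (force simp: incseq_def T_def W_def intro: less_le_trans)
  then have lim: "(\<lambda>k. prob (T k)) \<longlonglongrightarrow> prob (\<Union>k. T k)"
    using T by (intro finite_Lim_measure_incseq) auto
  have "AE x in bernoulli. x \<in> (\<Union>k. T k)"
    using conn
  proof eventually_elim
    case (elim x)
    then obtain w where w: "\<And>s. s \<in> S \<Longrightarrow> w s \<in> lists (carrier G) \<and> word_val G (w s) = s \<and>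
        walk G move (labelled_edges A) (w s) x"
      unfolding walk_connected_def by metis
    define k where "k = Suc (Max (insert 0 ((\<lambda>s. code (w s)) ` S)))"
    have "code (w s) < k" if "s \<in> S" for s
      unfolding k_def using S that by (simp add: le_imp_less_Suc)
    then have "x \<in> T k" using w by (auto simp: T_def W_def)
    then show ?case by auto
  qed
  then have "prob (\<Union>k. T k) = 1" using T by (intro prob_eq_1[THEN iffD2]) auto
  then have "eventually (\<lambda>k. 1 - \<delta> < prob (T k)) sequentially"
    using lim \<delta> by (intro order_tendstoD(1)) auto
  then obtain k where "1 - \<delta> < prob (T k)" by (auto simp: eventually_sequentially)
  then show ?thesis
    using that[of "W k"] finW T[of k] unfolding T_def by (auto simp: W_def)
qed

text \<open>The points at which finitely many words of the approximating cylinders do not suffice form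
  a small cylinder set; it is added to the set of every generator.\<close>

lemma finite_cylinder_graph:
  assumes price: "fixed_price G c" and S: "finite S" "S \<subseteq> carrier G" and \<epsilon>: "\<epsilon> > 0"
  obtains F D where "finite F" "F \<subseteq> carrier G" "\<And>g. D g \<in> cylinders" "\<And>g. g \<notin> F \<Longrightarrow> D g = {}"
    "(\<Sum>g\<in>F. measure bernoulli (D g)) \<le> c + \<epsilon>"
    "\<And>x. walk_connected G move (labelled_edges D) S x"
proof -
  interpret prob_space bernoulli by (rule prob_space_iid)
  \<comment> \<open>The three parts pay for the excess of the graphing over the cost, for the points
    that finitely many words miss, and for the approximation by cylinders.\<close>
  define \<epsilon>' where "\<epsilon>' = \<epsilon> / 3"
  have \<epsilon>': "\<epsilon>' > 0" using \<epsilon> by (simp add: \<epsilon>'_def)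
  obtain E where E: "E \<in> graphings bernoulli (orbit_relation G bernoulli shift)"
    "(\<integral>\<^sup>+x. graph_degree E x \<partial>bernoulli) < ennreal (2 * (c + \<epsilon>'))"
    using cheap_graphing(2)[OF price \<epsilon>'] by auto
  define A where "A = oriented E"
  have A: "A g \<in> events" for g
    using E oriented_sets unfolding A_def graphings_def by auto
  have sumA: "(\<Sum>g\<in>F. prob (A g)) \<le> c + \<epsilon>'" if "finite F" "F \<subseteq> carrier G" for F
    unfolding A_def by (rule oriented_measure_sum[OF E that])
  define \<delta> where "\<delta> = \<epsilon>' / (card S + 1)"
  have \<delta>: "\<delta> > 0" "card S * \<delta> \<le> \<epsilon>'" using \<epsilon>' by (auto simp: \<delta>_def field_simps)
  let ?T = "\<lambda>D W. {x. \<forall>s\<in>S. \<exists>w\<in>W. word_val G w = s \<and> walk G move (labelled_edges D) w x}"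
  obtain W where W: "finite W" "W \<subseteq> lists (carrier G)" "?T A W \<in> events" "prob (?T A W) > 1 - \<delta>"
    using finitely_many_words[OF A S(1) oriented_walk_connected[OF E(1) S(2), folded A_def] \<delta>(1)] .
  \<comment> \<open>\<open>S\<close> is included because the exceptional set will be attached to its
    elements, and inverses of letters because walks may cross edges backwards.\<close>
  define F where "F = S \<union> (\<Union>w\<in>W. set w) \<union> m_inv G ` (\<Union>w\<in>W. set w)"
  have F: "finite F" "F \<subseteq> carrier G" using S W by (auto simp: F_def)
  define L where "L = (\<Sum>w\<in>W. real (length w))"
  have L: "L \<ge> 0" by (auto simp: L_def intro: sum_nonneg)
  \<comment> \<open>Each of the \<open>card F\<close> approximations costs \<open>\<eta>\<close>,
    and lost walks cost \<open>2 * \<eta> * L\<close> for every generator. The words are fixed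
    before \<open>\<eta>\<close>, so \<open>L\<close> is a constant here; the added 1 keeps the
    denominator positive.\<close>
  define \<eta> where "\<eta> = \<epsilon>' / (card F + 2 * card S * L + 1)"
  have pos: "real (card F) + 2 * card S * L + 1 > 0" using L by (intro add_nonneg_pos) auto
  have \<eta>: "\<eta> > 0" using \<epsilon>' pos by (auto simp: \<eta>_def)
  have \<eta>2: "(card F + 2 * card S * L) * \<eta> \<le> \<epsilon>'"
  proof -
    have "(card F + 2 * card S * L) * \<eta> \<le> (card F + 2 * card S * L + 1) * \<eta>"
      using \<eta> by (intro mult_right_mono) auto
    also have "\<dots> = \<epsilon>'" using pos by (simp add: \<eta>_def)
    finally show ?thesis .
  qed
  have "\<exists>B. B \<in> cylinders \<and> prob (A g - B) < \<eta> \<and> prob (B - A g) < \<eta>" for g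
    using approximable_sets[OF A[of g]] \<eta> unfolding approximable_def by blast
  then obtain B where B: "\<And>g. B g \<in> cylinders \<and> prob (A g - B g) < \<eta> \<and> prob (B g - A g) < \<eta>" by metis
  define D0 where "D0 g = (if g \<in> F then B g else {})" for g
  have D0: "D0 g \<in> cylinders" for g using B by (simp add: D0_def cylinders_empty)
  have D0s: "D0 g \<in> events" for g using D0 cylinders_sets by auto
  have T'eq: "?T D0 W = (\<Inter>s\<in>S. \<Union>w\<in>{w \<in> W. word_val G w = s}. {x. walk G move (labelled_edges D0) w x})"
    by auto
  have T': "?T D0 W \<in> cylinders"
    unfolding T'eq using S W walk_set_cylinders[OF D0] by (intro cylinders_INT cylinders_UN) auto
  let ?N = "- ?T D0 W"
  have N: "?N \<in> cylinders" using T' by (rule cylinders_Compl)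
  have probN: "prob ?N \<le> \<delta> + 2 * \<eta> * L"
  proof -
    let ?d = "\<lambda>w. {x. walk G move (labelled_edges A) w x} - {x. walk G move (labelled_edges D0) w x}"
    have d: "?d w \<in> events" for w using walk_set_measurable[OF A] walk_set_measurable[OF D0s] by auto
    \<comment> \<open>A point fails for \<open>D0\<close> either because it failed for
      \<open>A\<close> or because the walk along some word of \<open>W\<close> was lost.\<close>
    have "?N \<subseteq> (space bernoulli - ?T A W) \<union> (\<Union>w\<in>W. ?d w)" unfolding space_iid by blast
    moreover have c: "space bernoulli - ?T A W \<in> events" by (rule sets.compl_sets[OF W(3)])
    moreover have u: "(\<Union>w\<in>W. ?d w) \<in> events" by (rule sets.finite_UN[OF W(1)]) (rule d)
    ultimately have "prob ?N \<le> prob ((space bernoulli - ?T A W) \<union> (\<Union>w\<in>W. ?d w))"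
      by (intro finite_measure_mono sets.Un)
    also have "\<dots> \<le> prob (space bernoulli - ?T A W) + prob (\<Union>w\<in>W. ?d w)"
      by (rule measure_Un_le[OF c u])
    also have "prob (space bernoulli - ?T A W) \<le> \<delta>"
      using prob_compl[OF W(3)] W(4) by simp
    also have "prob (\<Union>w\<in>W. ?d w) \<le> (\<Sum>w\<in>W. prob (?d w))"
      using W d by (intro finite_measure_subadditive_finite) auto
    also have "\<dots> \<le> (\<Sum>w\<in>W. 2 * \<eta> * length w)"
    proof (rule sum_mono)
      fix w assume w: "w \<in> W"
      show "prob (?d w) \<le> 2 * \<eta> * length w"
      proof (rule walk_difference[OF A D0s])
        show "w \<in> lists (carrier G)" using w W by auto
        fix g assume g: "g \<in> set w"
        then have "g \<in> F" "inv g \<in> F" using w by (auto simp: F_def)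
        then show "prob (A g - D0 g) \<le> \<eta> \<and> prob (A (inv g) - D0 (inv g)) \<le> \<eta>"
          using B by (simp add: D0_def less_imp_le)
      qed
    qed
    also have "\<dots> = 2 * \<eta> * L" by (simp add: L_def sum_distrib_left)
    finally show ?thesis by simp
  qed
  \<comment> \<open>On \<open>?N\<close> the word \<open>[s]\<close> is itself a walk for each
    generator, and off \<open>?N\<close> the words from \<open>W\<close> work. So no exceptional
    point remains.\<close>
  define D where "D g = D0 g \<union> (if g \<in> S then ?N else {})" for g
  have probD: "prob (D g) \<le> prob (A g) + \<eta> + (if g \<in> S then \<delta> + 2 * \<eta> * L else 0)" if "g \<in> F" for g
  proof -
    have "prob (D0 g) \<le> prob (A g \<union> (D0 g - A g))"
      using A D0s by (intro finite_measure_mono) auto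
    also have "\<dots> \<le> prob (A g) + prob (D0 g - A g)" using A D0s by (intro measure_Un_le) auto
    also have "prob (D0 g - A g) \<le> \<eta>" using B that by (simp add: D0_def less_imp_le)
    finally have "prob (D0 g) \<le> prob (A g) + \<eta>" by simp
    moreover have "prob (D g) \<le> prob (D0 g) + prob (if g \<in> S then ?N else {})"
      unfolding D_def using D0s cylinders_sets[OF N] by (intro measure_Un_le) auto
    ultimately show ?thesis using probN by (auto split: if_splits)
  qed
  have "(\<Sum>g\<in>F. prob (D g)) \<le> (\<Sum>g\<in>F. prob (A g) + \<eta> + (if g \<in> S then \<delta> + 2 * \<eta> * L else 0))"
    by (rule sum_mono) (rule probD)
  also have "\<dots> = (\<Sum>g\<in>F. prob (A g)) + card F * \<eta> + card (F \<inter> S) * (\<delta> + 2 * \<eta> * L)"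
    using F by (simp add: sum.distrib sum.If_cases)
  also have "F \<inter> S = S" by (auto simp: F_def)
  also have "(\<Sum>g\<in>F. prob (A g)) + card F * \<eta> + card S * (\<delta> + 2 * \<eta> * L) =
      (\<Sum>g\<in>F. prob (A g)) + card S * \<delta> + (card F + 2 * card S * L) * \<eta>"
    by (simp add: algebra_simps)
  also have "\<dots> \<le> (c + \<epsilon>') + \<epsilon>' + \<epsilon>'"
    using sumA[OF F] \<delta>(2) \<eta>2 by linarith
  also have "\<dots> = c + \<epsilon>" by (simp add: \<epsilon>'_def)
  finally have sumD: "(\<Sum>g\<in>F. prob (D g)) \<le> c + \<epsilon>" .
  have "walk_connected G move (labelled_edges D) S x" for x
    unfolding walk_connected_def
  proof
    fix s assume s: "s \<in> S"
    show "\<exists>w\<in>lists (carrier G). word_val G w = s \<and> walk G move (labelled_edges D) w x"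
    proof (cases "x \<in> ?T D0 W")
      case True
      then obtain w where "w \<in> W" "word_val G w = s" "walk G move (labelled_edges D0) w x" using s by auto
      then show ?thesis
        using W(2) walk_mono[of D0 D w x] by (auto simp: D_def intro!: bexI[of _ w])
    next
      case False
      then have "x \<in> D s" using s by (auto simp: D_def)
      then show ?thesis
        using s S(2) by (intro bexI[of _ "[s]"]) (auto simp: labelled_edges_def)
    qed
  qed
  moreover have "D g \<in> cylinders" for g
    unfolding D_def using D0 N by (auto intro: cylinders_Un)
  moreover have "D g = {}" if "g \<notin> F" for g
    using that by (auto simp: D_def D0_def F_def)
  ultimately show ?thesis using that[of F D] F sumD by blast
qed

section \<open>The upper bound\<close>

text \<open>Labels \<open>y\<close> on the cosets of \<open>H\<close> (and on the spare coordinates) are read off as a point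
  \<open>y \<circ> coset_index v\<close> of the shift space for every coset \<open>v\<close>; this is equivariant in \<open>v\<close>.\<close>

definition coset_index :: "'a set \<Rightarrow> nat \<Rightarrow> 'a set + nat" where
  "coset_index v n =
     (if n \<in> site ` carrier G then Inl (v #> the_inv_into (carrier G) site n) else Inr n)"

lemma coset_index_site [simp]: "h \<in> carrier G \<Longrightarrow> coset_index v (site h) = Inl (v #> h)"
  by (simp add: coset_index_def the_inv_into_f_f[OF inj_on_site])

lemma move_coset_index:
  assumes H: "subgroup H G" and v: "v \<in> rcosets H" and g: "g \<in> carrier G"
  shows "move (y \<circ> coset_index v) g = y \<circ> coset_index (v #> g)"
proof
  fix n
  show "move (y \<circ> coset_index v) g n = (y \<circ> coset_index (v #> g)) n"
  proof (cases "n \<in> site ` carrier G")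
    case True
    then obtain h where h: "h \<in> carrier G" "n = site h" by auto
    then show ?thesis using g rcoset_mult[OF H v g h(1)] by (simp add: move_site)
  next
    case False
    then show ?thesis by (simp add: move_def shift_def shift_index_other coset_index_def)
  qed
qed

lemma inj_on_coset_index:
  assumes "inj_on (\<lambda>h. v #> h) {h \<in> carrier G. site h \<in> D}"
  shows "inj_on (coset_index v) D"
proof (rule inj_onI)
  fix m n assume mn: "m \<in> D" "n \<in> D" "coset_index v m = coset_index v n"
  show "m = n"
  proof (cases "m \<in> site ` carrier G")
    case True
    then obtain h where h: "h \<in> carrier G" "m = site h" by auto
    with mn(3) have "n \<in> site ` carrier G" by (auto simp: coset_index_def split: if_splits)
    then obtain k where k: "k \<in> carrier G" "n = site k" by auto
    then show ?thesis using inj_onD[OF assms, of h k] h mn by simp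
  next
    case False
    then show ?thesis using mn(3) by (auto simp: coset_index_def split: if_splits)
  qed
qed

section \<open>Random graphs on the cosets\<close>

definition coset_edges ::
  "'a set \<Rightarrow> ('a \<Rightarrow> (nat \<Rightarrow> real) set) \<Rightarrow> 'a set \<Rightarrow> ('a set + nat \<Rightarrow> real) \<Rightarrow> ('a set \<times> 'a) set" where
  "coset_edges H D F y = {(v, g). v \<in> rcosets H \<and> g \<in> F \<and> y \<circ> coset_index v \<in> D g}"

text \<open>By equivariance a walk from \<open>y \<circ> coset_index v\<close> visits only points
  \<open>y \<circ> coset_index u\<close>, so each step is an edge at a coset \<open>u\<close>.
  Emptiness of \<open>D\<close> outside \<open>F\<close> puts the labels in
  \<open>F\<close>.\<close>

lemma coset_walk:
  assumes H: "subgroup H G" and D: "\<And>g. g \<notin> F \<Longrightarrow> D g = {}"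
    and "w \<in> lists (carrier G)" "v \<in> rcosets H" "walk G move (labelled_edges D) w (y \<circ> coset_index v)"
  shows "walk G (#>) (coset_edges H D F y) w v"
  using assms(3-)
proof (induction w arbitrary: v)
  case (Cons g w)
  have g: "g \<in> carrier G" "w \<in> lists (carrier G)" using Cons.hyps by auto
  have v: "v #> g \<in> rcosets H" using rcosets_closed[OF H Cons.prems(1) g(1)] .
  have mv: "move (y \<circ> coset_index v) g = y \<circ> coset_index (v #> g)"
    by (rule move_coset_index[OF H Cons.prems(1) g(1)])
  have edge: "(u, h) \<in> coset_edges H D F y"
    if "u \<in> rcosets H" "(y \<circ> coset_index u, h) \<in> labelled_edges D" for u h
    using that D[of h] unfolding coset_edges_def labelled_edges_def by blast
  have "((y \<circ> coset_index v, g) \<in> labelled_edges D \<or> (y \<circ> coset_index (v #> g), inv g) \<in> labelled_edges D) \<and>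
      walk G move (labelled_edges D) w (y \<circ> coset_index (v #> g))"
    using Cons.prems(2) unfolding walk.simps mv .
  then show ?case
    unfolding walk.simps using Cons.IH[OF v] edge[OF Cons.prems(1)] edge[OF v] by blast
qed simp

text \<open>The bound holds for each single labelling \<open>y\<close>, because \<open>D\<close>
  connects every point of the shift space, in particular those with repeated labels.\<close>

lemma rank_le_coset_edges:
  assumes H: "subgroup H G" "finite (rcosets H)" and S: "S \<subseteq> carrier G" "generate G S = carrier G"
    and F: "finite F" "F \<subseteq> carrier G" and D: "\<And>g. g \<notin> F \<Longrightarrow> D g = {}"
    and conn: "\<And>x. walk_connected G move (labelled_edges D) S x"
  shows "group_rank (G\<lparr>carrier := H\<rparr>) + card (rcosets H) \<le> card (coset_edges H D F y) + 1"
proof (rule rank_bound_edges[OF H S])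
  have sub: "coset_edges H D F y \<subseteq> (rcosets H) \<times> F" by (auto simp: coset_edges_def)
  show "finite (coset_edges H D F y)" by (rule finite_subset[OF sub]) (use H F in simp)
  show "coset_edges H D F y \<subseteq> (rcosets H) \<times> carrier G" using sub F by auto
  show "walk_connected G (#>) (coset_edges H D F y) S v" if v: "v \<in> rcosets H" for v
    unfolding walk_connected_def
  proof
    fix s assume "s \<in> S"
    then obtain w where w: "w \<in> lists (carrier G)" "word_val G w = s"
        "walk G move (labelled_edges D) w (y \<circ> coset_index v)"
      using conn unfolding walk_connected_def by blast
    then show "\<exists>w\<in>lists (carrier G). word_val G w = s \<and> walk G (#>) (coset_edges H D F y) w v"
      using coset_walk[OF H(1) D w(1) v w(3)] by blast
  qed
qed

text \<open>A lower bound for the edge count of every labelling also bounds its expectation. At a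
  coset with injective window each label has the probability of its cylinder; at any other coset
  every probability is bounded by 1, giving \<open>card F\<close>.\<close>

lemma rank_le_expected_edges:
  assumes H: "subgroup H G" "finite (rcosets H)" and S: "S \<subseteq> carrier G" "generate G S = carrier G"
    and F: "finite F" "F \<subseteq> carrier G" and D: "\<And>g. g \<notin> F \<Longrightarrow> D g = {}"
    and conn: "\<And>x. walk_connected G move (labelled_edges D) S x"
    and cyl: "\<And>g. D g \<in> sets bernoulli"
    and dep: "\<And>g x y. (\<And>n. n \<in> K \<Longrightarrow> x n = y n) \<Longrightarrow> x \<in> D g \<Longrightarrow> y \<in> D g"
  shows "real (group_rank (G\<lparr>carrier := H\<rparr>)) + card (rcosets H) \<le>
    card (rcosets H) * (\<Sum>g\<in>F. measure bernoulli (D g)) +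
    real (card F) * card {v \<in> rcosets H. \<not> inj_on (\<lambda>h. v #> h) {h \<in> carrier G. site h \<in> K}} + 1"
proof -
  let ?Y = "iid :: ('a set + nat \<Rightarrow> real) measure"
  interpret Y: prob_space ?Y by (rule prob_space_iid)
  let ?V = "rcosets H" and ?r = "real (group_rank (G\<lparr>carrier := H\<rparr>)) + card (rcosets H) - 1"
  let ?bad = "{v \<in> rcosets H. \<not> inj_on (\<lambda>h. v #> h) {h \<in> carrier G. site h \<in> K}}"
  let ?X = "\<lambda>v g. (\<lambda>y. y \<circ> coset_index v) -` D g"
  have X: "?X v g \<in> Y.events" for v g
    using measurable_sets[OF measurable_iid_comp cyl, of "coset_index v" g] by simp
  have card_eq: "real (card (coset_edges H D F y)) = (\<Sum>v\<in>?V. \<Sum>g\<in>F. indicator (?X v g) y)" for y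
  proof -
    have "coset_edges H D F y = (SIGMA v:?V. {g \<in> F. y \<circ> coset_index v \<in> D g})"
      by (auto simp: coset_edges_def)
    then show ?thesis
      using H(2) F(1) by (simp add: card_SigmaI indicator_def sum.If_cases Int_def)
  qed
  have int: "integrable ?Y (\<lambda>y. \<Sum>v\<in>?V. \<Sum>g\<in>F. indicator (?X v g) y :: real)"
    using X by (intro Bochner_Integration.integrable_sum integrable_real_indicator) (auto simp: Y.emeasure_eq_measure)
  have "?r \<le> real (card (coset_edges H D F y))" for y
    using rank_le_coset_edges[OF H S F D conn, where y = y] by linarith
  then have "?r \<le> Y.expectation (\<lambda>y. \<Sum>v\<in>?V. \<Sum>g\<in>F. indicator (?X v g) y)"
    unfolding card_eq by (intro Y.integral_ge_const int AE_I2)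
  also have "\<dots> = (\<Sum>v\<in>?V. \<Sum>g\<in>F. Y.prob (?X v g))"
    using X by (simp add: Bochner_Integration.integral_sum Y.emeasure_eq_measure)
  also have "\<dots> \<le> (\<Sum>v\<in>?V. (\<Sum>g\<in>F. measure bernoulli (D g)) + (if v \<in> ?bad then real (card F) else 0))"
  proof (rule sum_mono)
    fix v assume v: "v \<in> ?V"
    show "(\<Sum>g\<in>F. Y.prob (?X v g)) \<le> (\<Sum>g\<in>F. measure bernoulli (D g)) + (if v \<in> ?bad then real (card F) else 0)"
    proof (cases "v \<in> ?bad")
      case True
      have "(\<Sum>g\<in>F. Y.prob (?X v g)) \<le> (\<Sum>g\<in>F. 1)" by (intro sum_mono) simp
      also have "\<dots> \<le> (\<Sum>g\<in>F. measure bernoulli (D g)) + real (card F)" by (simp add: sum_nonneg)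
      finally show ?thesis using True by simp
    next
      case False
      then have inj: "inj_on (coset_index v) K" using v by (intro inj_on_coset_index) auto
      have "emeasure ?Y (?X v g) = emeasure bernoulli (D g)" for g
        using cyl dep inj by (rule cylinder_window_measure[where D = K])
      then have "Y.prob (?X v g) = measure bernoulli (D g)" for g by (simp add: measure_def)
      then show ?thesis using False by simp
    qed
  qed
  also have "\<dots> = card ?V * (\<Sum>g\<in>F. measure bernoulli (D g)) + card F * card ?bad"
    using H(2) by (simp add: sum.distrib sum.If_cases Int_def mult.commute conj_assoc[symmetric])
  finally show ?thesis by simp
qed

text \<open>The cylinder graph is chosen once, independently of \<open>n\<close>, at the price of
  half of \<open>\<epsilon>\<close>. The other half eventually absorbs the cosets with folded
  windows.\<close>

lemma rank_ratio_upper: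
  assumes price: "fixed_price G c"
    and S: "finite_symmetric_generating_set G S" and farber: "farber_wrt G S H"
    and H: "\<And>n. subgroup (H n) G" "\<And>n. finite (rcosets (H n))"
    and \<epsilon>: "\<epsilon> > 0"
  shows "eventually (\<lambda>n. rank_ratio G (H n) < c - 1 + \<epsilon>) sequentially"
proof -
  have S': "finite S" "S \<subseteq> carrier G" "generate G S = carrier G"
    using S by (auto simp: finite_symmetric_generating_set_def)
  obtain F D where F: "finite F" "F \<subseteq> carrier G" and D: "\<And>g. D g \<in> cylinders" "\<And>g. g \<notin> F \<Longrightarrow> D g = {}"
    and sum: "(\<Sum>g\<in>F. measure bernoulli (D g)) \<le> c + \<epsilon> / 2"
    and conn: "\<And>x. walk_connected G move (labelled_edges D) S x"
    using finite_cylinder_graph[OF price S'(1,2), of "\<epsilon> / 2"] \<epsilon> by (metis half_gt_zero)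
  have "\<exists>K. finite K \<and> (\<forall>x y. (\<forall>n\<in>K. x n = y n) \<longrightarrow> x \<in> D g \<longrightarrow> y \<in> D g)" for g
    using D(1)[of g] by (auto simp: cylinders_def)
  then obtain K where K: "\<And>g. finite (K g)"
    "\<And>g x y. (\<And>n. n \<in> K g \<Longrightarrow> x n = y n) \<Longrightarrow> x \<in> D g \<Longrightarrow> y \<in> D g" by metis
  let ?K = "\<Union>g\<in>F. K g"
  have dep: "y \<in> D g" if "\<And>n. n \<in> ?K \<Longrightarrow> x n = y n" "x \<in> D g" for g x y
  proof (cases "g \<in> F")
    case True
    then show ?thesis using K(2)[of g x y] that by auto
  next
    case False
    then show ?thesis using D(2)[of g] that(2) by simp
  qed
  \<comment> \<open>Only coordinates that are sites can collide; spare ones keep distinct values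
    under \<open>Inr\<close>. Since \<open>site\<close> is injective, this window is finite.\<close>
  let ?W = "{h \<in> carrier G. site h \<in> ?K}"
  have "finite (site -` ?K \<inter> carrier G)"
    using F K(1) by (intro finite_vimage_IntI inj_on_site) auto
  moreover have "site -` ?K \<inter> carrier G = ?W" by auto
  ultimately have W: "finite ?W" "?W \<subseteq> carrier G" by auto
  let ?q = "\<lambda>n. real (card {v \<in> rcosets (H n). \<not> inj_on (\<lambda>h. v #> h) ?W}) / real (card (rcosets (H n)))"
  have "?q \<longlonglongrightarrow> 0" by (rule farber_injective_windows[OF S farber H W])
  then have "(\<lambda>n. c - 1 + \<epsilon> / 2 + card F * ?q n) \<longlonglongrightarrow> c - 1 + \<epsilon> / 2 + real (card F) * 0"
    by (intro tendsto_intros)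
  then have "eventually (\<lambda>n. c - 1 + \<epsilon> / 2 + card F * ?q n < c - 1 + \<epsilon>) sequentially"
    using \<epsilon> by (intro order_tendstoD(2)) auto
  then show ?thesis
  proof eventually_elim
    case (elim n)
    let ?N = "real (card (rcosets (H n)))"
    let ?b = "real (card {v \<in> rcosets (H n). \<not> inj_on (\<lambda>h. v #> h) ?W})"
    have N: "?N > 0" using H(2) rcosets_nonempty[OF H] by (simp add: card_gt_0_iff)
    have "real (group_rank (G\<lparr>carrier := H n\<rparr>)) + ?N \<le>
      ?N * (\<Sum>g\<in>F. measure bernoulli (D g)) + card F * ?b + 1"
      using H(1)[of n] H(2)[of n] S'(2,3) F D(2) conn cylinders_sets[OF D(1)] dep
      by (rule rank_le_expected_edges)
    also have "\<dots> \<le> ?N * (c + \<epsilon> / 2) + card F * ?b + 1"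
      using sum N by (intro add_mono mult_left_mono) auto
    finally have "real (group_rank (G\<lparr>carrier := H n\<rparr>)) - 1 \<le> ?N * (c - 1 + \<epsilon> / 2) + card F * ?b"
      by (simp add: algebra_simps)
    then have "rank_ratio G (H n) \<le> (?N * (c - 1 + \<epsilon> / 2) + card F * ?b) / ?N"
      unfolding rank_ratio_def subgroup_index_def using N by (intro divide_right_mono) auto
    also have "\<dots> = c - 1 + \<epsilon> / 2 + card F * ?q n" using N by (simp add: add_divide_distrib)
    finally show ?case using elim by simp
  qed
qed

end

theorem theorem4:
  fixes \<Gamma> :: "('a, 'b) monoid_scheme" and c :: real and H :: "nat \<Rightarrow> 'a set"
  assumes "group \<Gamma>" and "finitely_generated \<Gamma>" and "fixed_price \<Gamma> c"
    and "farber_sequence \<Gamma> H"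
  shows "rank_gradient_exists \<Gamma> H \<and> rank_gradient \<Gamma> H = c - 1"
proof -
  interpret group \<Gamma> by fact
  obtain S where S: "finite_symmetric_generating_set \<Gamma> S" "farber_wrt \<Gamma> S H"
    and H: "\<And>n. subgroup (H n) \<Gamma>" "\<And>n. finite (rcosets\<^bsub>\<Gamma>\<^esub> (H n))"
    using assms(4) by (auto simp: farber_sequence_def)
  have S': "finite S" "S \<subseteq> carrier \<Gamma>" "generate \<Gamma> S = carrier \<Gamma>"
    using S by (auto simp: finite_symmetric_generating_set_def)
  \<comment> \<open>Every element is the product of a word over the finite set
    \<open>S\<close>.\<close>
  interpret countable_group \<Gamma>
  proof
    have "carrier \<Gamma> \<subseteq> word_val \<Gamma> ` lists S"
      using words_of_generators[OF S(1)] by blast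
    then show "countable (carrier \<Gamma>)"
      using countable_lists[OF countable_finite[OF S'(1)]] by (meson countable_image countable_subset)
  qed
  \<comment> \<open>The lower bound holds for every \<open>n\<close> and the upper one eventually,
    so convergence and the value of the limit come together.\<close>
  have "(\<lambda>n. rank_ratio \<Gamma> (H n)) \<longlonglongrightarrow> c - 1"
  proof (rule order_tendstoI)
    fix a assume "a < c - 1"
    moreover have "c - 1 \<le> rank_ratio \<Gamma> (H n)" for n
      using rank_ratio_lower[OF assms(3) H S'] .
    ultimately show "eventually (\<lambda>n. a < rank_ratio \<Gamma> (H n)) sequentially"
      by (simp add: less_le_trans)
  next
    fix a assume "c - 1 < a"
    then show "eventually (\<lambda>n. rank_ratio \<Gamma> (H n) < a) sequentially"
      using rank_ratio_upper[OF assms(3) S H, of "a - (c - 1)"] by simp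
  qed
  then show ?thesis
    unfolding rank_gradient_exists_def rank_gradient_def by (auto simp: convergent_def limI)
qed

end
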